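(* Let $\Omega=\mathbb{T}^1$, let $\mu$ be a smooth positive function on $(0,\infty)$, and let $\mathcal{E}\colon\mathcal{M}\to\mathbb{R}$ be a smooth functional. The flux-gradient flow of $\mathcal{E}(\rho,m)$ in $(\mathcal{M},\mathrm{g})$ satisfies $$\left\{\begin{aligned}&\partial_t\rho+\partial_xf_1(\rho,m)=0,\\&\partial_tm+\partial_xf_2(\rho,m)=\partial_x\Big(\mu(\rho)\partial_x\frac{\delta}{\delta m}\mathcal{E}(\rho,m)\Big),\end{aligned}\right.\qquad( * )$$ where $(f_1,f_2)$ is a flux function assumed to satisfy $$\int_\Omega\Big(f_1(\rho,m)\,\partial_x\frac{\delta}{\delta\rho}\mathcal{E}(\rho,m)+f_2(\rho,m)\,\partial_x\frac{\delta}{\delta m}\mathcal{E}(\rho,m)\Big)dx=0.$$ In this case $\mathcal{E}(\rho,m)$ is a Lyapunov functional for $( * )$; precisely, along solutions of $( * )$, $$\frac{d}{dt}\mathcal{E}(\rho(t,\cdot),m(t,\cdot))=-\int_\Omega\Big|\partial_x\frac{\delta}{\delta m}\mathcal{E}(\rho,m)(t,x)\Big|^2\mu(\rho(t,x))\,dx.$$ In particular, let $\beta>0$, let $P$ be smooth on $(0,\infty)$ and let $\hat P$ satisfy $\hat P''(\rho)=P'(\rho)/\rho$. If $$\mathcal{E}(\rho,m)=\beta\int_\Omega\Big(\frac{m(x)^2}{2\rho(x)}+\hat P(\rho(x))\Big)dx,\qquad f_1(\rho,m)=m,\quad f_2(\rho,m)=\frac{m^2}{\rho}+P(\rho),$$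 then the flux-gradient flow $( * )$ is the barotropic compressible Navier--Stokes system $$\partial_t\rho+\partial_xm=0,\qquad\partial_tm+\partial_x\Big(\frac{m^2}{\rho}\Big)+\partial_xP(\rho)=\beta\,\partial_x\Big(\mu(\rho)\partial_x\frac m\rho\Big).$$
   Context: $\mathbb{T}^1$ is the one-dimensional torus. $\mathcal{M}=\{(\rho,m)\in C^\infty(\Omega)^2\colon\rho>0,\ \int_\Omega\rho\,dx=c_1,\ \int_\Omega m\,dx=c_2\}$ with constants $c_1>0$, $c_2\in\mathbb{R}$; the tangent space at $u=(\rho,m)$ is $T_u\mathcal{M}=\{(\dot\rho,\dot m)\in C^\infty(\Omega)^2\colon\int_\Omega\dot\rho\,dx=\int_\Omega\dot m\,dx=0\}$. The degenerate metric is $\mathrm{g}(\rho,m)((\dot\rho_1,\dot m_1),(\dot\rho_2,\dot m_2))=\int_\Omega\partial_x\psi_1\,\partial_x\psi_2\,\mu(\rho)\,dx$ with $\dot m_i=-\partial_x(\mu(\rho)\partial_x\psi_i)$. The gradient flow of $\mathcal{E}$ in $(\mathcal{M},\mathrm{g})$ is $$\begin{pmatrix}\partial_t\rho\\\partial_tm\end{pmatrix}=-\begin{pmatrix}0&0\\0&-\Delta_{\mu(\rho)}\end{pmatrix}\begin{pmatrix}\frac{\delta}{\delta\rho}\mathcal{E}\\\frac{\delta}{\delta m}\mathcal{E}\end{pmatrix},\qquad\Delta_{\mu(\rho)}f=\partial_x(\mu(\rho)\partial_xf).$$ A flux-gradient flow of $\mathcal{E}$ is obtained by adding to the left-hand side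 of the gradient flow the term $(\partial_xf_1,\partial_xf_2)$ with a flux satisfying the stated integral (orthogonality) condition. $\frac{\delta}{\delta\rho},\frac{\delta}{\delta m}$ are $L^2$ first variations. Solutions are smooth with $\rho>0$. *)

theory Defs
  imports "HOL-Analysis.Analysis"
begin

text \<open>
  The torus is \<open>\<real>/\<int>\<close>: functions on it are 1-periodic functions on \<open>\<real>\<close>, and integrals over it
  are integrals over \<open>{0..1}\<close>.
\<close>

type_synonym torus_fun = "real \<Rightarrow> real"
type_synonym state = "torus_fun \<times> torus_fun"

text \<open>Only meant for open \<open>S\<close>; values of \<open>f\<close> off \<open>S\<close> are then irrelevant.\<close>

definition smooth_on :: "real set \<Rightarrow> (real \<Rightarrow> real) \<Rightarrow> bool" where
  "smooth_on S f \<longleftrightarrow> (\<forall>n. \<forall>x\<in>S. ((deriv ^^ n) f) differentiable (at x))"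

definition smooth_torus :: "torus_fun set" where
  "smooth_torus = {f. (\<forall>x. f (x + 1) = f x) \<and> smooth_on UNIV f}"

definition torus_integral :: "torus_fun \<Rightarrow> real" where
  "torus_integral f = integral {0..1} f"

definition state_space :: "real \<Rightarrow> real \<Rightarrow> state set" where
  "state_space c1 c2 =
     {(r, m). r \<in> smooth_torus \<and> m \<in> smooth_torus \<and> (\<forall>x. r x > 0) \<and>
        torus_integral r = c1 \<and> torus_integral m = c2}"

text \<open>The tangent space of \<open>state_space c1 c2\<close>, which is the same at every point.\<close>

definition tangent_space :: "state set" where
  "tangent_space =
     {(h, k). h \<in> smooth_torus \<and> k \<in> smooth_torus \<and> torus_integral h = 0 \<and> torus_integral k = 0}"

definition shift :: "state \<Rightarrow> state \<Rightarrow> real \<Rightarrow> state" where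
  "shift u h s = ((\<lambda>x. fst u x + s * fst h x), (\<lambda>x. snd u x + s * snd h x))"

text \<open>Convergence in the Frechet topology of \<open>C\<^sup>\<infinity>\<close>: uniform convergence of all derivatives.\<close>

definition smooth_conv :: "(nat \<Rightarrow> torus_fun) \<Rightarrow> torus_fun \<Rightarrow> bool" where
  "smooth_conv F f \<longleftrightarrow>
     (\<forall>k. uniform_limit UNIV (\<lambda>n. (deriv ^^ k) (F n)) ((deriv ^^ k) f) sequentially)"

definition state_conv :: "(nat \<Rightarrow> state) \<Rightarrow> state \<Rightarrow> bool" where
  "state_conv U u \<longleftrightarrow> smooth_conv (\<lambda>n. fst (U n)) (fst u) \<and> smooth_conv (\<lambda>n. snd (U n)) (snd u)"

text \<open>
  Smoothness in the usual sense for Frechet manifolds (Michal--Bastiani, Hamilton): iterated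
  directional derivatives of all orders exist and are jointly continuous in the base point and
  all directions. Here \<open>D [h\<^sub>k, \<dots>, h\<^sub>1] u\<close> is the \<open>k\<close>-th derivative at \<open>u\<close>. The topology is
  metrizable, so sequential continuity is continuity.
\<close>

definition smooth_functional :: "real \<Rightarrow> real \<Rightarrow> (state \<Rightarrow> real) \<Rightarrow> bool" where
  "smooth_functional c1 c2 E \<longleftrightarrow>
     (\<exists>D :: state list \<Rightarrow> state \<Rightarrow> real.
        (\<forall>u \<in> state_space c1 c2. D [] u = E u) \<and>
        (\<forall>u \<in> state_space c1 c2. \<forall>h \<in> tangent_space. \<forall>hs. set hs \<subseteq> tangent_space \<longrightarrow>
           ((\<lambda>s. D hs (shift u h s)) has_real_derivative D (h # hs) u) (at 0)) \<and>
        (\<forall>U u H hs.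
           (\<forall>n. U n \<in> state_space c1 c2) \<and> u \<in> state_space c1 c2 \<and>
           (\<forall>n. set (H n) \<subseteq> tangent_space \<and> length (H n) = length hs) \<and>
           set hs \<subseteq> tangent_space \<and>
           state_conv U u \<and> (\<forall>i < length hs. state_conv (\<lambda>n. H n ! i) (hs ! i)) \<longrightarrow>
           (\<lambda>n. D (H n) (U n)) \<longlonglongrightarrow> D hs u))"

text \<open>
  \<open>dr u\<close> and \<open>dm u\<close> are \<open>L\<^sup>2\<close> first variations of \<open>E\<close> at \<open>u\<close> with respect to the two components.
  Since tangent vectors have mean zero, each is determined only up to an additive constant.
\<close>

definition first_variations ::
  "real \<Rightarrow> real \<Rightarrow> (state \<Rightarrow> real) \<Rightarrow> (state \<Rightarrow> torus_fun) \<Rightarrow> (state \<Rightarrow> torus_fun) \<Rightarrow> bool" where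
  "first_variations c1 c2 E dr dm \<longleftrightarrow>
     (\<forall>u \<in> state_space c1 c2.
        dr u \<in> smooth_torus \<and> dm u \<in> smooth_torus \<and>
        (\<forall>h \<in> tangent_space.
           ((\<lambda>s. E (shift u h s)) has_real_derivative
              torus_integral (\<lambda>x. dr u x * fst h x + dm u x * snd h x)) (at 0)))"

definition weighted_laplacian :: "(real \<Rightarrow> real) \<Rightarrow> torus_fun \<Rightarrow> torus_fun \<Rightarrow> torus_fun" where
  "weighted_laplacian \<mu> r f = deriv (\<lambda>x. \<mu> (r x) * deriv f x)"

definition potential :: "(real \<Rightarrow> real) \<Rightarrow> state \<Rightarrow> state \<Rightarrow> torus_fun \<Rightarrow> bool" where
  "potential \<mu> u v \<psi> \<longleftrightarrow>
     \<psi> \<in> smooth_torus \<and> snd v = (\<lambda>x. - weighted_laplacian \<mu> (fst u) \<psi> x)"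

text \<open>
  Potentials exist on tangent vectors and are unique up to constants, so the description picks
  out a unique number.
\<close>

definition metric :: "(real \<Rightarrow> real) \<Rightarrow> state \<Rightarrow> state \<Rightarrow> state \<Rightarrow> real" where
  "metric \<mu> u v1 v2 =
     (THE g. \<exists>\<psi>1 \<psi>2. potential \<mu> u v1 \<psi>1 \<and> potential \<mu> u v2 \<psi>2 \<and>
        g = torus_integral (\<lambda>x. deriv \<psi>1 x * deriv \<psi>2 x * \<mu> (fst u x)))"

text \<open>
  The metric is degenerate with kernel \<open>{(h, 0)}\<close>, so a gradient can only be represented in the
  directions \<open>(0, k)\<close>.
\<close>

definition is_metric_gradient :: "(real \<Rightarrow> real) \<Rightarrow> (state \<Rightarrow> real) \<Rightarrow> state \<Rightarrow> state \<Rightarrow> bool" where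
  "is_metric_gradient \<mu> E u w \<longleftrightarrow>
     w \<in> tangent_space \<and> fst w = (\<lambda>x. 0) \<and>
     (\<forall>h \<in> tangent_space. fst h = (\<lambda>x. 0) \<longrightarrow>
        ((\<lambda>s. E (shift u h s)) has_real_derivative metric \<mu> u w h) (at 0))"

text \<open>The operator matrix \<open>(0, 0; 0, - weighted_laplacian)\<close> at the state \<open>u\<close>.\<close>

definition onsager :: "(real \<Rightarrow> real) \<Rightarrow> state \<Rightarrow> state \<Rightarrow> state" where
  "onsager \<mu> u \<xi> = ((\<lambda>x. 0), (\<lambda>x. - weighted_laplacian \<mu> (fst u) (snd \<xi>) x))"

text \<open>
  All iterated partial derivatives in \<open>t \<in> I\<close> and \<open>x\<close>, in any order, exist and are continuous;
  at an endpoint belonging to \<open>I\<close> the time derivative is one-sided.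
\<close>

coinductive smooth_in_spacetime :: "real set \<Rightarrow> (real \<Rightarrow> real \<Rightarrow> real) \<Rightarrow> bool" for I where
  "\<lbrakk>continuous_on (I \<times> UNIV) (\<lambda>(t, x). f t x);
    \<And>t x. t \<in> I \<Longrightarrow> ((\<lambda>s. f s x) has_real_derivative ft t x) (at t within I);
    \<And>t x. t \<in> I \<Longrightarrow> ((\<lambda>y. f t y) has_real_derivative fx t x) (at x);
    smooth_in_spacetime I ft; smooth_in_spacetime I fx\<rbrakk> \<Longrightarrow> smooth_in_spacetime I f"

definition time_deriv :: "real set \<Rightarrow> (real \<Rightarrow> real \<Rightarrow> real) \<Rightarrow> real \<Rightarrow> real \<Rightarrow> real" where
  "time_deriv I f t x = vector_derivative (\<lambda>s. f s x) (at t within I)"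

definition smooth_evolution ::
  "real \<Rightarrow> real \<Rightarrow> real set \<Rightarrow> (real \<Rightarrow> torus_fun) \<Rightarrow> (real \<Rightarrow> torus_fun) \<Rightarrow> bool" where
  "smooth_evolution c1 c2 I r m \<longleftrightarrow>
     is_interval I \<and> interior I \<noteq> {} \<and>
     smooth_in_spacetime I r \<and> smooth_in_spacetime I m \<and>
     (\<forall>t\<in>I. (r t, m t) \<in> state_space c1 c2)"

text \<open>
  Fluxes are maps from states to functions on the torus, which covers fluxes that are pointwise
  functions of the state.
\<close>

definition admissible_flux ::
  "real \<Rightarrow> real \<Rightarrow> (state \<Rightarrow> torus_fun) \<Rightarrow> (state \<Rightarrow> torus_fun) \<Rightarrow>
   (state \<Rightarrow> torus_fun) \<Rightarrow> (state \<Rightarrow> torus_fun) \<Rightarrow> bool" where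
  "admissible_flux c1 c2 dr dm f1 f2 \<longleftrightarrow>
     (\<forall>u \<in> state_space c1 c2.
        f1 u \<in> smooth_torus \<and> f2 u \<in> smooth_torus \<and>
        torus_integral (\<lambda>x. f1 u x * deriv (dr u) x + f2 u x * deriv (dm u) x) = 0)"

definition flux_gradient_flow ::
  "real \<Rightarrow> real \<Rightarrow> (real \<Rightarrow> real) \<Rightarrow> (state \<Rightarrow> real) \<Rightarrow>
   (state \<Rightarrow> torus_fun) \<Rightarrow> (state \<Rightarrow> torus_fun) \<Rightarrow>
   (state \<Rightarrow> torus_fun) \<Rightarrow> (state \<Rightarrow> torus_fun) \<Rightarrow>
   real set \<Rightarrow> (real \<Rightarrow> torus_fun) \<Rightarrow> (real \<Rightarrow> torus_fun) \<Rightarrow> bool" where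
  "flux_gradient_flow c1 c2 \<mu> E dr dm f1 f2 I r m \<longleftrightarrow>
     first_variations c1 c2 E dr dm \<and>
     admissible_flux c1 c2 dr dm f1 f2 \<and>
     (\<forall>t\<in>I. \<forall>x.
        let u = (r t, m t); w = onsager \<mu> u (dr u, dm u) in
          time_deriv I r t x + deriv (f1 u) x = - fst w x \<and>
          time_deriv I m t x + deriv (f2 u) x = - snd w x)"

definition dissipative_system ::
  "(real \<Rightarrow> real) \<Rightarrow> (state \<Rightarrow> torus_fun) \<Rightarrow> (state \<Rightarrow> torus_fun) \<Rightarrow> (state \<Rightarrow> torus_fun) \<Rightarrow>
   real set \<Rightarrow> (real \<Rightarrow> torus_fun) \<Rightarrow> (real \<Rightarrow> torus_fun) \<Rightarrow> bool" where
  "dissipative_system \<mu> dm f1 f2 I r m \<longleftrightarrow>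
     (\<forall>t\<in>I. \<forall>x.
        time_deriv I r t x + deriv (f1 (r t, m t)) x = 0 \<and>
        time_deriv I m t x + deriv (f2 (r t, m t)) x =
          deriv (\<lambda>y. \<mu> (r t y) * deriv (dm (r t, m t)) y) x)"

definition barotropic_energy :: "real \<Rightarrow> (real \<Rightarrow> real) \<Rightarrow> state \<Rightarrow> real" where
  "barotropic_energy \<beta> Phat u =
     \<beta> * torus_integral (\<lambda>x. (snd u x)\<^sup>2 / (2 * fst u x) + Phat (fst u x))"

definition barotropic_flux1 :: "state \<Rightarrow> torus_fun" where
  "barotropic_flux1 u = snd u"

definition barotropic_flux2 :: "(real \<Rightarrow> real) \<Rightarrow> state \<Rightarrow> torus_fun" where
  "barotropic_flux2 P u = (\<lambda>x. (snd u x)\<^sup>2 / fst u x + P (fst u x))"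

definition barotropic_navier_stokes ::
  "real \<Rightarrow> (real \<Rightarrow> real) \<Rightarrow> (real \<Rightarrow> real) \<Rightarrow>
   real set \<Rightarrow> (real \<Rightarrow> torus_fun) \<Rightarrow> (real \<Rightarrow> torus_fun) \<Rightarrow> bool" where
  "barotropic_navier_stokes \<beta> \<mu> P I r m \<longleftrightarrow>
     (\<forall>t\<in>I. \<forall>x.
        time_deriv I r t x + deriv (m t) x = 0 \<and>
        time_deriv I m t x + deriv (\<lambda>y. (m t y)\<^sup>2 / r t y) x + deriv (\<lambda>y. P (r t y)) x =
          \<beta> * deriv (\<lambda>y. \<mu> (r t y) * deriv (\<lambda>z. m t z / r t z) y) x)"

end

theory Submission
  imports Defs
begin

text \<open>
  The onsager operator inverts the map from velocities to potentials, so it produces the metric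
  gradient by the fundamental lemma of the calculus of variations. For the dissipation identity, the
  difference quotients \<open>(u(s) - u(t)) / (s - t)\<close> of a smooth evolution converge in \<open>C\<^sup>\<infinity>\<close>, and the
  mean value theorem on the segment from \<open>u(t)\<close> to \<open>u(s)\<close> together with the joint continuity of the
  directional derivative gives the chain rule; integrating by parts, the flux drops out by orthogonality.
  In the barotropic case the orthogonality holds because, with \<open>v = m / \<rho>\<close>, the integrand is the exact
  derivative \<open>\<beta> \<partial>\<^sub>x (P(\<rho>) v)\<close>.
\<close>

section \<open>Smooth functions of one variable\<close>

lemma smooth_on_coinduct:
  assumes "open S" "f \<in> X"
    and step: "\<And>f. f \<in> X \<Longrightarrow> \<exists>g\<in>X. \<forall>x\<in>S. (f has_real_derivative g x) (at x)"
  shows "smooth_on S f"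
proof -
  have iterate: "\<exists>g\<in>X. \<forall>x\<in>S. (deriv ^^ n) f x = g x" if "f \<in> X" for n f
    using that
  proof (induction n)
    case 0
    then show ?case by auto
  next
    case (Suc n)
    then obtain g where g: "g \<in> X" "\<forall>x\<in>S. (deriv ^^ n) f x = g x"
      by blast
    obtain g' where g': "g' \<in> X" "\<forall>x\<in>S. (g has_real_derivative g' x) (at x)"
      using step[OF g(1)] by blast
    have "((deriv ^^ n) f has_real_derivative g' x) (at x)" if "x \<in> S" for x
      by (rule has_field_derivative_transform_within_open[of g _ x S]) (use that g g' \<open>open S\<close> in auto)
    then have "\<forall>x\<in>S. (deriv ^^ Suc n) f x = g' x"
      by (auto intro: DERIV_imp_deriv)
    with g'(1) show ?case by blast
  qed
  show ?thesis
    unfolding smooth_on_def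
  proof (intro allI ballI)
    fix n x assume x: "x \<in> S"
    obtain g where g: "g \<in> X" "\<forall>x\<in>S. (deriv ^^ n) f x = g x"
      using iterate[OF assms(2)] by blast
    obtain g' where g': "\<forall>x\<in>S. (g has_real_derivative g' x) (at x)"
      using step[OF g(1)] by blast
    have "((deriv ^^ n) f has_real_derivative g' x) (at x)"
      by (rule has_field_derivative_transform_within_open[of g _ x S]) (use x g g' \<open>open S\<close> in auto)
    then show "(deriv ^^ n) f differentiable at x"
      using real_differentiable_def by blast
  qed
qed

lemma smooth_on_deriv:
  assumes "smooth_on S f"
  shows "smooth_on S (deriv f)"
  unfolding smooth_on_def
proof (intro allI ballI)
  fix n x assume "x \<in> S"
  then have "(deriv ^^ Suc n) f differentiable at x"
    using assms by (auto simp: smooth_on_def simp del: funpow.simps)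
  then show "(deriv ^^ n) (deriv f) differentiable at x"
    by (simp add: funpow_Suc_right del: funpow.simps)
qed

lemma smooth_on_higher_deriv: "smooth_on S f \<Longrightarrow> smooth_on S ((deriv ^^ n) f)"
  by (induction n) (auto intro: smooth_on_deriv)

lemma smooth_on_has_deriv:
  assumes "smooth_on S f" "x \<in> S"
  shows "(f has_real_derivative deriv f x) (at x)"
proof -
  have "(deriv ^^ 0) f differentiable at x"
    using assms unfolding smooth_on_def by blast
  then show ?thesis
    by (simp add: DERIV_deriv_iff_real_differentiable)
qed

lemma smooth_on_continuous: "smooth_on S f \<Longrightarrow> continuous_on S f"
  by (metis smooth_on_has_deriv DERIV_isCont continuous_at_imp_continuous_on)

text \<open>Closed under differentiation, so coinduction applies to all its members at once.\<close>

inductive_set smooth_closure :: "real set \<Rightarrow> (real \<Rightarrow> real) set" for S where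
  base: "smooth_on S f \<Longrightarrow> f \<in> smooth_closure S"
| const: "(\<lambda>x. c) \<in> smooth_closure S"
| ident: "(\<lambda>x. x) \<in> smooth_closure S"
| add: "\<lbrakk>f \<in> smooth_closure S; g \<in> smooth_closure S\<rbrakk> \<Longrightarrow> (\<lambda>x. f x + g x) \<in> smooth_closure S"
| mult: "\<lbrakk>f \<in> smooth_closure S; g \<in> smooth_closure S\<rbrakk> \<Longrightarrow> (\<lambda>x. f x * g x) \<in> smooth_closure S"
| comp: "\<lbrakk>smooth_on T f; g \<in> smooth_closure S; \<And>x. x \<in> S \<Longrightarrow> g x \<in> T\<rbrakk>
    \<Longrightarrow> (\<lambda>x. f (g x)) \<in> smooth_closure S"
| inverse: "\<lbrakk>f \<in> smooth_closure S; \<And>x. x \<in> S \<Longrightarrow> f x \<noteq> 0\<rbrakk>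
    \<Longrightarrow> (\<lambda>x. inverse (f x)) \<in> smooth_closure S"

lemma smooth_closure_imp_smooth_on:
  assumes "open S" "f \<in> smooth_closure S"
  shows "smooth_on S f"
proof (rule smooth_on_coinduct[OF assms])
  fix f assume "f \<in> smooth_closure S"
  then show "\<exists>g\<in>smooth_closure S. \<forall>x\<in>S. (f has_real_derivative g x) (at x)"
  proof induction
    case (base f)
    then show ?case
      using smooth_on_has_deriv smooth_on_deriv smooth_closure.base by blast
  next
    case (const c)
    have "(\<lambda>x. 0) \<in> smooth_closure S"
      by (rule smooth_closure.const)
    then show ?case by (rule bexI[rotated]) auto
  next
    case ident
    have "(\<lambda>x. 1) \<in> smooth_closure S"
      by (rule smooth_closure.const)
    then show ?case by (rule bexI[rotated]) auto
  next
    case (add f g)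
    then obtain f' g' where D: "f' \<in> smooth_closure S" "g' \<in> smooth_closure S"
      "\<forall>x\<in>S. (f has_real_derivative f' x) (at x)" "\<forall>x\<in>S. (g has_real_derivative g' x) (at x)"
      by blast
    then have "(\<lambda>x. f' x + g' x) \<in> smooth_closure S"
      by (intro smooth_closure.add)
    then show ?case
      by (rule bexI[rotated]) (auto intro!: derivative_eq_intros D[rule_format])
  next
    case (mult f g)
    then obtain f' g' where D: "f' \<in> smooth_closure S" "g' \<in> smooth_closure S"
      "\<forall>x\<in>S. (f has_real_derivative f' x) (at x)" "\<forall>x\<in>S. (g has_real_derivative g' x) (at x)"
      by blast
    then have "(\<lambda>x. f' x * g x + g' x * f x) \<in> smooth_closure S"
      using mult by (intro smooth_closure.add smooth_closure.mult)
    then show ?case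
      by (rule bexI[rotated]) (auto intro!: derivative_eq_intros D[rule_format])
  next
    case (comp T f g)
    then obtain g' where D: "g' \<in> smooth_closure S" "\<forall>x\<in>S. (g has_real_derivative g' x) (at x)"
      by blast
    have "(\<lambda>x. deriv f (g x)) \<in> smooth_closure S"
      using comp smooth_on_deriv smooth_closure.comp[of T "deriv f" g] by blast
    then have mem: "(\<lambda>x. deriv f (g x) * g' x) \<in> smooth_closure S"
      using D by (intro smooth_closure.mult)
    have "\<forall>x\<in>S. ((\<lambda>x. f (g x)) has_real_derivative deriv f (g x) * g' x) (at x)"
      using comp(1,3) D(2) by (blast intro: DERIV_chain2[of f] smooth_on_has_deriv)
    then show ?case by (rule bexI[OF _ mem])
  next
    case (inverse f)
    then obtain f' where D: "f' \<in> smooth_closure S" "\<forall>x\<in>S. (f has_real_derivative f' x) (at x)"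
      by blast
    have "(\<lambda>x. (- 1) * (inverse (f x) * (f' x * inverse (f x)))) \<in> smooth_closure S"
      using inverse D by (intro smooth_closure.mult smooth_closure.const smooth_closure.inverse)
    then show ?case
      by (rule bexI[rotated]) (auto intro!: derivative_eq_intros D[rule_format] inverse)
  qed
qed

lemma smooth_on_const [simp]: "open S \<Longrightarrow> smooth_on S (\<lambda>x. c)"
  by (rule smooth_closure_imp_smooth_on[OF _ smooth_closure.const])

lemma smooth_on_ident: "open S \<Longrightarrow> smooth_on S (\<lambda>x. x)"
  by (rule smooth_closure_imp_smooth_on[OF _ smooth_closure.ident])

lemma smooth_on_add: "\<lbrakk>open S; smooth_on S f; smooth_on S g\<rbrakk> \<Longrightarrow> smooth_on S (\<lambda>x. f x + g x)"
  by (rule smooth_closure_imp_smooth_on[OF _ smooth_closure.add]) (auto intro: smooth_closure.base)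

lemma smooth_on_mult: "\<lbrakk>open S; smooth_on S f; smooth_on S g\<rbrakk> \<Longrightarrow> smooth_on S (\<lambda>x. f x * g x)"
  by (rule smooth_closure_imp_smooth_on[OF _ smooth_closure.mult]) (auto intro: smooth_closure.base)

lemma smooth_on_compose:
  "\<lbrakk>open S; smooth_on T f; smooth_on S g; \<And>x. x \<in> S \<Longrightarrow> g x \<in> T\<rbrakk> \<Longrightarrow> smooth_on S (\<lambda>x. f (g x))"
  by (rule smooth_closure_imp_smooth_on[OF _ smooth_closure.comp[of T]]) (auto intro: smooth_closure.base)

lemma smooth_on_inverse:
  "\<lbrakk>open S; smooth_on S f; \<And>x. x \<in> S \<Longrightarrow> f x \<noteq> 0\<rbrakk> \<Longrightarrow> smooth_on S (\<lambda>x. inverse (f x))"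
  by (rule smooth_closure_imp_smooth_on[OF _ smooth_closure.inverse]) (auto intro: smooth_closure.base)

lemma smooth_on_cmult: "\<lbrakk>open S; smooth_on S f\<rbrakk> \<Longrightarrow> smooth_on S (\<lambda>x. c * f x)"
  by (intro smooth_on_mult smooth_on_const)

lemma smooth_on_divide:
  "\<lbrakk>open S; smooth_on S f; smooth_on S g; \<And>x. x \<in> S \<Longrightarrow> g x \<noteq> 0\<rbrakk> \<Longrightarrow> smooth_on S (\<lambda>x. f x / g x)"
  unfolding divide_inverse by (intro smooth_on_mult smooth_on_inverse)

lemma smooth_on_antiderivative:
  assumes "open S" "smooth_on S f'" "\<And>x. x \<in> S \<Longrightarrow> (f has_real_derivative f' x) (at x)"
  shows "smooth_on S f"
proof (rule smooth_on_coinduct[where X = "insert f (Collect (smooth_on S))"])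
  fix h assume h: "h \<in> insert f (Collect (smooth_on S))"
  then show "\<exists>h'\<in>insert f (Collect (smooth_on S)). \<forall>x\<in>S. (h has_real_derivative h' x) (at x)"
    using assms smooth_on_deriv smooth_on_has_deriv by blast
qed (use assms in auto)

lemma higher_deriv_add_cmult:
  assumes "smooth_on UNIV f" "smooth_on UNIV g"
  shows "(deriv ^^ k) (\<lambda>x. f x + c * g x) = (\<lambda>x. (deriv ^^ k) f x + c * (deriv ^^ k) g x)"
proof (induction k)
  case (Suc k)
  have "((\<lambda>x. (deriv ^^ k) f x + c * (deriv ^^ k) g x) has_real_derivative
      (deriv ^^ Suc k) f x + c * (deriv ^^ Suc k) g x) (at x)" for x
    using assms[THEN smooth_on_higher_deriv[where n=k]]
    by (auto intro!: DERIV_add DERIV_diff DERIV_cmult smooth_on_has_deriv)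
  then show ?case
    using Suc by (auto intro!: DERIV_imp_deriv)
qed auto

lemma higher_deriv_cmult_diff:
  assumes "smooth_on UNIV f" "smooth_on UNIV g"
  shows "(deriv ^^ k) (\<lambda>x. c * (f x - g x)) = (\<lambda>x. c * ((deriv ^^ k) f x - (deriv ^^ k) g x))"
proof (induction k)
  case (Suc k)
  have "((\<lambda>x. c * ((deriv ^^ k) f x - (deriv ^^ k) g x)) has_real_derivative
      c * ((deriv ^^ Suc k) f x - (deriv ^^ Suc k) g x)) (at x)" for x
    using assms[THEN smooth_on_higher_deriv[where n=k]]
    by (auto intro!: DERIV_add DERIV_diff DERIV_cmult smooth_on_has_deriv)
  then show ?case
    using Suc by (auto intro!: DERIV_imp_deriv)
qed auto

section \<open>Smooth functions on the torus\<close>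

lemma smooth_torusI: "\<lbrakk>\<And>x. f (x + 1) = f x; smooth_on UNIV f\<rbrakk> \<Longrightarrow> f \<in> smooth_torus"
  by (simp add: smooth_torus_def)

lemma smooth_torusD:
  assumes "f \<in> smooth_torus"
  shows smooth_torus_periodic: "f (x + 1) = f x" and smooth_torus_smooth_on: "smooth_on UNIV f"
  using assms by (auto simp: smooth_torus_def)

lemma smooth_torus_has_deriv: "f \<in> smooth_torus \<Longrightarrow> (f has_real_derivative deriv f x) (at x)"
  by (auto intro: smooth_on_has_deriv smooth_torusD)

lemma smooth_torus_continuous: "f \<in> smooth_torus \<Longrightarrow> continuous_on A f"
  by (meson smooth_on_continuous smooth_torusD continuous_on_subset subset_UNIV)

lemma smooth_torus_const: "(\<lambda>x. c) \<in> smooth_torus"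
  by (rule smooth_torusI) auto

lemma smooth_torus_add: "\<lbrakk>f \<in> smooth_torus; g \<in> smooth_torus\<rbrakk> \<Longrightarrow> (\<lambda>x. f x + g x) \<in> smooth_torus"
  by (rule smooth_torusI) (auto intro: smooth_on_add simp: smooth_torusD)

lemma smooth_torus_mult: "\<lbrakk>f \<in> smooth_torus; g \<in> smooth_torus\<rbrakk> \<Longrightarrow> (\<lambda>x. f x * g x) \<in> smooth_torus"
  by (rule smooth_torusI) (auto intro: smooth_on_mult simp: smooth_torusD)

lemma smooth_torus_cmult: "f \<in> smooth_torus \<Longrightarrow> (\<lambda>x. c * f x) \<in> smooth_torus"
  by (intro smooth_torus_mult smooth_torus_const)

lemma smooth_torus_minus: "f \<in> smooth_torus \<Longrightarrow> (\<lambda>x. - f x) \<in> smooth_torus"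
  using smooth_torus_cmult[of f "- 1"] by simp

lemma smooth_torus_diff: "\<lbrakk>f \<in> smooth_torus; g \<in> smooth_torus\<rbrakk> \<Longrightarrow> (\<lambda>x. f x - g x) \<in> smooth_torus"
  using smooth_torus_add[of f "\<lambda>x. - g x"] smooth_torus_minus by simp

lemma smooth_torus_power: "f \<in> smooth_torus \<Longrightarrow> (\<lambda>x. f x ^ n) \<in> smooth_torus"
  by (induction n) (auto intro: smooth_torus_const smooth_torus_mult)

lemma smooth_torus_divide:
  "\<lbrakk>f \<in> smooth_torus; g \<in> smooth_torus; \<And>x. g x \<noteq> 0\<rbrakk> \<Longrightarrow> (\<lambda>x. f x / g x) \<in> smooth_torus"
  by (rule smooth_torusI) (auto intro: smooth_on_divide simp: smooth_torusD)

lemma smooth_torus_compose: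
  assumes "smooth_on T f" "g \<in> smooth_torus" "\<And>x. g x \<in> T"
  shows "(\<lambda>x. f (g x)) \<in> smooth_torus"
  using smooth_on_compose[OF open_UNIV assms(1)] assms(2,3)
  by (auto intro!: smooth_torusI simp: smooth_torusD)

lemma smooth_torus_deriv:
  assumes "f \<in> smooth_torus"
  shows "deriv f \<in> smooth_torus"
proof (rule smooth_torusI)
  fix x
  have "((\<lambda>x. f (x + 1)) has_real_derivative deriv f (x + 1)) (at x)"
    using smooth_torus_has_deriv[OF assms, of "x + 1"] by (simp only: DERIV_shift)
  then show "deriv f (x + 1) = deriv f x"
    using smooth_torus_periodic[OF assms] by (simp add: DERIV_imp_deriv)
qed (use assms in \<open>auto intro: smooth_on_deriv smooth_torusD\<close>)

lemma smooth_torus_higher_deriv: "f \<in> smooth_torus \<Longrightarrow> (deriv ^^ n) f \<in> smooth_torus"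
  by (induction n) (auto intro: smooth_torus_deriv)

lemmas smooth_torus_intros = smooth_torus_const smooth_torus_add smooth_torus_mult
  smooth_torus_minus smooth_torus_diff smooth_torus_power smooth_torus_deriv

lemma periodic_frac:
  fixes f :: "real \<Rightarrow> 'a"
  assumes "\<And>x. f (x + 1) = f x"
  shows "f (frac x) = f x"
proof -
  have nat: "f (x + real n) = f x" for n x
  proof (induction n)
    case (Suc n)
    then show ?case
      using assms[of "x + real n"] by (simp add: algebra_simps)
  qed simp
  show ?thesis
  proof (cases "\<lfloor>x\<rfloor> \<ge> 0")
    case True
    then show ?thesis
      using nat[of "frac x" "nat \<lfloor>x\<rfloor>"] by (simp add: frac_def)
  next
    case False
    then show ?thesis
      using nat[of x "nat (- \<lfloor>x\<rfloor>)"] by (simp add: frac_def)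
  qed
qed

lemma frac_in_unit: "frac (x::real) \<in> {0..1}"
  by (simp add: frac_lt_1 less_imp_le)

lemma smooth_torus_bounded:
  assumes "f \<in> smooth_torus"
  obtains M where "M > 0" "\<And>x. \<bar>f x\<bar> \<le> M"
proof -
  have "bounded (f ` {0..1})"
    by (intro compact_imp_bounded compact_continuous_image smooth_torus_continuous assms) auto
  then obtain M where M: "M > 0" "\<forall>x\<in>{0..1}. \<bar>f x\<bar> \<le> M"
    unfolding bounded_pos by auto
  show thesis
  proof (rule that[OF M(1)])
    show "\<bar>f x\<bar> \<le> M" for x
      using M(2) frac_in_unit[of x] periodic_frac[of f x] smooth_torus_periodic[OF assms] by metis
  qed
qed

lemma smooth_torus_lower_bound:
  assumes "f \<in> smooth_torus" "\<And>x. f x > 0"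
  obtains e where "e > 0" "\<And>x. f x \<ge> e"
proof -
  obtain y where "y \<in> {0..1}" and y: "\<forall>x\<in>{0..1}. f y \<le> f x"
    using continuous_attains_inf[of "{0..1::real}" f] smooth_torus_continuous[OF assms(1)] by auto
  show thesis
  proof (rule that[OF assms(2)[of y]])
    show "f y \<le> f x" for x
      using y frac_in_unit[of x] periodic_frac[of f x] smooth_torus_periodic[OF assms(1)] by metis
  qed
qed

lemma smooth_torus_has_integral:
  "f \<in> smooth_torus \<Longrightarrow> (f has_integral torus_integral f) {0..1}"
  unfolding torus_integral_def
  by (intro integrable_integral integrable_continuous_interval smooth_torus_continuous)

lemma torus_integralI: "(f has_integral i) {0..1} \<Longrightarrow> torus_integral f = i"
  unfolding torus_integral_def by (rule integral_unique)

lemma torus_integral_add: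
  "\<lbrakk>f \<in> smooth_torus; g \<in> smooth_torus\<rbrakk> \<Longrightarrow>
    torus_integral (\<lambda>x. f x + g x) = torus_integral f + torus_integral g"
  by (intro torus_integralI has_integral_add smooth_torus_has_integral)

lemma torus_integral_diff:
  "\<lbrakk>f \<in> smooth_torus; g \<in> smooth_torus\<rbrakk> \<Longrightarrow>
    torus_integral (\<lambda>x. f x - g x) = torus_integral f - torus_integral g"
  by (intro torus_integralI has_integral_diff smooth_torus_has_integral)

lemma torus_integral_cmult: "torus_integral (\<lambda>x. c * f x) = c * torus_integral f"
  unfolding torus_integral_def by simp

lemma torus_integral_minus: "torus_integral (\<lambda>x. - f x) = - torus_integral f"
  unfolding torus_integral_def by simp

lemma torus_integral_const [simp]: "torus_integral (\<lambda>x. c) = c"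
  unfolding torus_integral_def by simp

lemma torus_integral_deriv:
  assumes "f \<in> smooth_torus"
  shows "torus_integral (deriv f) = 0"
proof -
  have "(deriv f has_integral f 1 - f 0) {0..1}"
    by (rule fundamental_theorem_of_calculus)
      (auto intro: has_field_derivative_at_within smooth_torus_has_deriv[OF assms]
        simp flip: has_real_derivative_iff_has_vector_derivative)
  then show ?thesis
    using smooth_torus_periodic[OF assms, of 0] by (simp add: torus_integralI)
qed

lemma torus_integral_by_parts:
  assumes "f \<in> smooth_torus" "g \<in> smooth_torus"
  shows "torus_integral (\<lambda>x. f x * deriv g x) = - torus_integral (\<lambda>x. deriv f x * g x)"
proof -
  have "deriv (\<lambda>x. f x * g x) = (\<lambda>x. deriv f x * g x + f x * deriv g x)"
    by (rule ext, rule DERIV_imp_deriv)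
      (auto intro!: derivative_eq_intros smooth_torus_has_deriv assms)
  then have "torus_integral (\<lambda>x. deriv f x * g x + f x * deriv g x) = 0"
    using torus_integral_deriv[OF smooth_torus_mult[OF assms]] by simp
  then show ?thesis
    by (subst (asm) torus_integral_add) (auto intro!: smooth_torus_intros assms)
qed

lemma torus_antiderivative:
  assumes "k \<in> smooth_torus" "torus_integral k = 0"
  obtains K where "K \<in> smooth_torus" "\<And>x. (K has_real_derivative k x) (at x)"
proof -
  have "isCont k x" for x
    using smooth_torus_continuous[OF assms(1), of UNIV] by (simp add: continuous_on_eq_continuous_at)
  then obtain K where "\<forall>x. (K has_vector_derivative k x) (at x)"
    using einterval_antiderivative[of "-\<infinity>" "\<infinity>" k] by auto
  then have K: "(K has_real_derivative k x) (at x)" for x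
    by (simp add: has_real_derivative_iff_has_vector_derivative)
  have "((\<lambda>x. K (x + 1)) has_real_derivative k x) (at x)" for x
    using K[of "x + 1"] by (simp only: DERIV_shift smooth_torus_periodic[OF assms(1)])
  then have "((\<lambda>x. K (x + 1) - K x) has_real_derivative 0) (at x)" for x
    using DERIV_diff[OF _ K, of "\<lambda>x. K (x + 1)" "k x" x] by simp
  then have shift: "K (x + 1) - K x = K (0 + 1) - K 0" for x
    using DERIV_isconst_all[of "\<lambda>x. K (x + 1) - K x" x 0] by blast
  have "(k has_integral K 1 - K 0) {0..1}"
    by (rule fundamental_theorem_of_calculus)
      (auto intro: has_field_derivative_at_within K
        simp flip: has_real_derivative_iff_has_vector_derivative)
  then have "K 1 = K 0"
    using torus_integralI assms(2) by fastforce
  then have "K (x + 1) = K x" for x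
    using shift[of x] by simp
  then have "K \<in> smooth_torus"
    by (rule smooth_torusI) (rule smooth_on_antiderivative[OF open_UNIV smooth_torus_smooth_on[OF assms(1)] K])
  then show thesis
    using K that by blast
qed

lemma torus_integral_square_eq_0:
  assumes "f \<in> smooth_torus" "torus_integral (\<lambda>x. f x * f x) = 0"
  shows "f x = 0"
proof -
  have "\<forall>x\<in>{0..1}. f x * f x = 0"
    using assms(2) unfolding torus_integral_def
    by (subst (asm) integral_eq_0_iff)
      (auto intro!: continuous_on_mult smooth_torus_continuous[OF assms(1)])
  then show ?thesis
    using frac_in_unit[of x] periodic_frac[of f x] smooth_torus_periodic[OF assms(1)] by auto
qed

lemma torus_du_Bois_Reymond:
  assumes "g \<in> smooth_torus"
    and "\<And>k. \<lbrakk>k \<in> smooth_torus; torus_integral k = 0\<rbrakk> \<Longrightarrow> torus_integral (\<lambda>x. g x * k x) = 0"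
  shows "g x = torus_integral g"
proof -
  define c where "c = torus_integral g"
  define k where "k = (\<lambda>x. g x - c)"
  have k: "k \<in> smooth_torus"
    unfolding k_def by (intro smooth_torus_intros assms)
  have 0: "torus_integral k = 0"
    unfolding k_def by (subst torus_integral_diff) (auto simp: c_def intro: assms smooth_torus_const)
  have "torus_integral (\<lambda>x. g x * k x - c * k x) = 0"
    using assms(2)[OF k 0] 0 k
    by (subst torus_integral_diff) (auto simp: torus_integral_cmult intro!: smooth_torus_intros assms)
  then have "torus_integral (\<lambda>x. k x * k x) = 0"
    by (simp add: k_def algebra_simps)
  then show ?thesis
    using torus_integral_square_eq_0[OF k] by (simp add: k_def c_def)
qed

section \<open>The degenerate metric\<close>

lemma state_spaceD:
  assumes "u \<in> state_space c1 c2"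
  shows "fst u \<in> smooth_torus" "snd u \<in> smooth_torus" "fst u x > 0"
    "torus_integral (fst u) = c1" "torus_integral (snd u) = c2"
  using assms by (auto simp: state_space_def)

lemma tangent_spaceD:
  assumes "h \<in> tangent_space"
  shows "fst h \<in> smooth_torus" "snd h \<in> smooth_torus"
    "torus_integral (fst h) = 0" "torus_integral (snd h) = 0"
  using assms by (auto simp: tangent_space_def)

lemma first_variationsD:
  assumes "first_variations c1 c2 E dr dm" "u \<in> state_space c1 c2"
  shows "dr u \<in> smooth_torus" "dm u \<in> smooth_torus"
    "h \<in> tangent_space \<Longrightarrow> ((\<lambda>s. E (shift u h s)) has_real_derivative
       torus_integral (\<lambda>x. dr u x * fst h x + dm u x * snd h x)) (at 0)"
  using assms by (auto simp: first_variations_def)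

lemma torus_integral_pos:
  assumes "f \<in> smooth_torus" "\<And>x. f x > 0"
  shows "torus_integral f > 0"
proof -
  obtain e where e: "e > 0" "\<And>x. f x \<ge> e"
    using smooth_torus_lower_bound[OF assms] by blast
  have "torus_integral (\<lambda>x. e) \<le> torus_integral f"
    by (rule has_integral_le[OF smooth_torus_has_integral smooth_torus_has_integral])
      (use e assms in \<open>auto intro: smooth_torus_const\<close>)
  with e show ?thesis by simp
qed

lemma deriv_eq_if_torus_integrals_eq:
  assumes fg: "f \<in> smooth_torus" "g \<in> smooth_torus"
    and eq: "\<And>k. \<lbrakk>k \<in> smooth_torus; torus_integral k = 0\<rbrakk> \<Longrightarrow>
      torus_integral (\<lambda>x. f x * k x) = torus_integral (\<lambda>x. g x * k x)"
  shows "deriv f = deriv g"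
proof -
  have "torus_integral (\<lambda>x. (f x - g x) * k x) = 0" if "k \<in> smooth_torus" "torus_integral k = 0" for k
    using torus_integral_diff[of "\<lambda>x. f x * k x" "\<lambda>x. g x * k x"] eq[OF that] that fg
    by (simp add: algebra_simps smooth_torus_mult)
  then have "f x - g x = torus_integral (\<lambda>x. f x - g x)" for x
    using torus_du_Bois_Reymond[OF smooth_torus_diff[OF fg]] by blast
  then obtain c where c: "f x = g x + c" for x
    by (metis add.commute diff_add_cancel)
  have "(f has_real_derivative deriv g x) (at x)" for x
    unfolding c by (auto intro!: derivative_eq_intros smooth_torus_has_deriv fg)
  then show ?thesis
    by (auto intro: DERIV_imp_deriv)
qed

lemma first_variations_deriv_unique:
  assumes "first_variations c1 c2 E dr dm" "first_variations c1 c2 E dr' dm'" "u \<in> state_space c1 c2"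
  shows "deriv (dr u) = deriv (dr' u)" "deriv (dm u) = deriv (dm' u)"
proof -
  have eq: "torus_integral (\<lambda>x. dr u x * fst h x + dm u x * snd h x) =
      torus_integral (\<lambda>x. dr' u x * fst h x + dm' u x * snd h x)" if "h \<in> tangent_space" for h
    using first_variationsD(3)[OF assms(1,3) that] first_variationsD(3)[OF assms(2,3) that]
    by (rule DERIV_unique)
  show "deriv (dr u) = deriv (dr' u)"
  proof (rule deriv_eq_if_torus_integrals_eq)
    fix k assume "k \<in> smooth_torus" "torus_integral k = 0"
    then show "torus_integral (\<lambda>x. dr u x * k x) = torus_integral (\<lambda>x. dr' u x * k x)"
      using eq[of "(k, \<lambda>x. 0)"] by (simp add: tangent_space_def smooth_torus_const)
  qed (use assms first_variationsD in blast)+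
  show "deriv (dm u) = deriv (dm' u)"
  proof (rule deriv_eq_if_torus_integrals_eq)
    fix k assume "k \<in> smooth_torus" "torus_integral k = 0"
    then show "torus_integral (\<lambda>x. dm u x * k x) = torus_integral (\<lambda>x. dm' u x * k x)"
      using eq[of "(\<lambda>x. 0, k)"] by (simp add: tangent_space_def smooth_torus_const)
  qed (use assms first_variationsD in blast)+
qed

context
  fixes \<mu> :: "real \<Rightarrow> real"
  assumes smooth: "smooth_on {0<..} \<mu>" and pos: "\<And>s. s > 0 \<Longrightarrow> \<mu> s > 0"
begin

lemma smooth_torus_mobility: "u \<in> state_space c1 c2 \<Longrightarrow> (\<lambda>x. \<mu> (fst u x)) \<in> smooth_torus"
  by (rule smooth_torus_compose[OF smooth]) (auto intro: state_spaceD)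

lemma smooth_torus_weighted_deriv:
  "\<lbrakk>u \<in> state_space c1 c2; \<psi> \<in> smooth_torus\<rbrakk> \<Longrightarrow> (\<lambda>x. \<mu> (fst u x) * deriv \<psi> x) \<in> smooth_torus"
  by (intro smooth_torus_mult smooth_torus_mobility smooth_torus_deriv)

lemma potential_exists:
  assumes u: "u \<in> state_space c1 c2" and h: "h \<in> tangent_space"
  obtains \<psi> where "potential \<mu> u h \<psi>"
proof -
  define w where "w = (\<lambda>x. 1 / \<mu> (fst u x))"
  have pos: "\<mu> (fst u x) > 0" for x
    using state_spaceD(3)[OF u] pos by blast
  obtain K where K: "K \<in> smooth_torus" "\<And>x. (K has_real_derivative snd h x) (at x)"
    using torus_antiderivative tangent_spaceD(2,4)[OF h] by blast
  have w: "w \<in> smooth_torus"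
    unfolding w_def using pos by (intro smooth_torus_divide smooth_torus_const smooth_torus_mobility[OF u])
      (metis less_irrefl)
  have wpos: "torus_integral w > 0"
    using pos by (intro torus_integral_pos w) (auto simp: w_def)
  define c where "c = torus_integral (\<lambda>x. K x * w x) / torus_integral w"
  have "c * torus_integral w = torus_integral (\<lambda>x. K x * w x)"
    using wpos by (simp add: c_def)
  then have "torus_integral (\<lambda>x. c * w x - K x * w x) = 0"
    using w K(1) by (simp add: torus_integral_diff smooth_torus_cmult smooth_torus_mult torus_integral_cmult)
  moreover have "(\<lambda>x. c * w x - K x * w x) \<in> smooth_torus"
    using w K by (intro smooth_torus_intros)
  ultimately obtain \<psi> where \<psi>: "\<psi> \<in> smooth_torus"
    "\<And>x. (\<psi> has_real_derivative c * w x - K x * w x) (at x)"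
    using torus_antiderivative by blast
  have "\<mu> (fst u x) * deriv \<psi> x = c - K x" for x
    using pos[of x] DERIV_imp_deriv[OF \<psi>(2)[of x]] by (simp add: w_def field_simps)
  moreover have "((\<lambda>x. c - K x) has_real_derivative - snd h x) (at x)" for x
    by (auto intro!: derivative_eq_intros K)
  ultimately have "weighted_laplacian \<mu> (fst u) \<psi> x = - snd h x" for x
    unfolding weighted_laplacian_def by (simp add: DERIV_imp_deriv)
  then have "potential \<mu> u h \<psi>"
    using \<psi>(1) by (simp add: potential_def)
  then show thesis by (rule that)
qed

lemma potential_pairing:
  assumes u: "u \<in> state_space c1 c2" and \<psi>: "potential \<mu> u v \<psi>" and \<phi>: "\<phi> \<in> smooth_torus"
  shows "torus_integral (\<lambda>x. deriv \<phi> x * deriv \<psi> x * \<mu> (fst u x)) = torus_integral (\<lambda>x. \<phi> x * snd v x)"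
proof -
  have \<psi>': "\<psi> \<in> smooth_torus" "snd v = (\<lambda>x. - deriv (\<lambda>x. \<mu> (fst u x) * deriv \<psi> x) x)"
    using \<psi> by (auto simp: potential_def weighted_laplacian_def)
  have "torus_integral (\<lambda>x. \<phi> x * snd v x) =
      - torus_integral (\<lambda>x. \<phi> x * deriv (\<lambda>x. \<mu> (fst u x) * deriv \<psi> x) x)"
    unfolding \<psi>' by (simp add: torus_integral_minus)
  also have "\<dots> = torus_integral (\<lambda>x. deriv \<phi> x * (\<mu> (fst u x) * deriv \<psi> x))"
    using torus_integral_by_parts[OF \<phi> smooth_torus_weighted_deriv[OF u \<psi>'(1)]] by simp
  finally show ?thesis
    by (simp add: mult_ac)
qed

text \<open>By symmetry of the integral, \<open>potential_pairing\<close> can be applied to either argument, so the value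
  does not depend on the choice of either potential.\<close>

lemma metric_eq:
  assumes u: "u \<in> state_space c1 c2" and \<psi>: "potential \<mu> u v1 \<psi>1" "potential \<mu> u v2 \<psi>2"
  shows "metric \<mu> u v1 v2 = torus_integral (\<lambda>x. \<psi>1 x * snd v2 x)"
proof -
  have torus: "\<psi> \<in> smooth_torus" if "potential \<mu> u v \<psi>" for v \<psi>
    using that by (simp add: potential_def)
  let ?G = "\<lambda>\<psi> \<phi>. torus_integral (\<lambda>x. deriv \<psi> x * deriv \<phi> x * \<mu> (fst u x))"
  have comm: "?G \<psi> \<phi> = ?G \<phi> \<psi>" for \<psi> \<phi>
    by (simp add: mult_ac)
  have "?G \<phi>1 \<phi>2 = ?G \<psi>1 \<psi>2" if "potential \<mu> u v1 \<phi>1" "potential \<mu> u v2 \<phi>2" for \<phi>1 \<phi>2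
    using potential_pairing[OF u that(2) torus[OF that(1)]] potential_pairing[OF u \<psi>(2) torus[OF that(1)]]
      potential_pairing[OF u that(1) torus[OF \<psi>(2)]] potential_pairing[OF u \<psi>(1) torus[OF \<psi>(2)]]
      comm[of \<phi>1 \<psi>2] comm[of \<psi>1 \<psi>2] by simp
  then have "metric \<mu> u v1 v2 = ?G \<psi>1 \<psi>2"
    unfolding metric_def using \<psi> by (intro the_equality) blast+
  then show ?thesis
    using potential_pairing[OF u \<psi>(2) torus[OF \<psi>(1)]] by simp
qed

lemma onsager_tangent:
  assumes "u \<in> state_space c1 c2" "snd \<xi> \<in> smooth_torus"
  shows "onsager \<mu> u \<xi> \<in> tangent_space"
  using smooth_torus_weighted_deriv[OF assms]
  by (auto simp: onsager_def tangent_space_def weighted_laplacian_def torus_integral_minus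
      torus_integral_deriv intro!: smooth_torus_intros)

lemma potential_onsager: "snd \<xi> \<in> smooth_torus \<Longrightarrow> potential \<mu> u (onsager \<mu> u \<xi>) (snd \<xi>)"
  by (simp add: potential_def onsager_def)

lemma is_metric_gradient_iff_onsager:
  assumes fv: "first_variations c1 c2 E dr dm" and u: "u \<in> state_space c1 c2"
  shows "is_metric_gradient \<mu> E u w \<longleftrightarrow> w = onsager \<mu> u (dr u, dm u)"
proof
  note dm = first_variationsD(2)[OF fv u]
  have var: "((\<lambda>s. E (shift u h s)) has_real_derivative torus_integral (\<lambda>x. dm u x * snd h x)) (at 0)"
    if "h \<in> tangent_space" "fst h = (\<lambda>x. 0)" for h
    using first_variationsD(3)[OF fv u that(1)] that(2) by simp
  {
    assume "w = onsager \<mu> u (dr u, dm u)"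
    then have w: "w \<in> tangent_space" "fst w = (\<lambda>x. 0)" "potential \<mu> u w (dm u)"
      using onsager_tangent[OF u, of "(dr u, dm u)"] potential_onsager[of "(dr u, dm u)"] dm
      by (auto simp: onsager_def)
    have "((\<lambda>s. E (shift u h s)) has_real_derivative metric \<mu> u w h) (at 0)"
      if h: "h \<in> tangent_space" "fst h = (\<lambda>x. 0)" for h
    proof -
      obtain \<psi> where "potential \<mu> u h \<psi>"
        using potential_exists[OF u h(1)] .
      then show ?thesis
        using var[OF h] metric_eq[OF u w(3)] by simp
    qed
    with w show "is_metric_gradient \<mu> E u w"
      by (simp add: is_metric_gradient_def)
  next
    assume grad: "is_metric_gradient \<mu> E u w"
    then have w: "w \<in> tangent_space" "fst w = (\<lambda>x. 0)"
      by (auto simp: is_metric_gradient_def)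
    obtain \<psi> where \<psi>: "potential \<mu> u w \<psi>"
      using potential_exists[OF u w(1)] .
    have "deriv \<psi> = deriv (dm u)"
    proof (rule deriv_eq_if_torus_integrals_eq)
      fix k assume "k \<in> smooth_torus" "torus_integral k = 0"
      then have h: "(\<lambda>x. 0, k) \<in> tangent_space"
        by (simp add: tangent_space_def smooth_torus_const)
      obtain \<phi> where "potential \<mu> u (\<lambda>x. 0, k) \<phi>"
        using potential_exists[OF u h] .
      then have "metric \<mu> u w (\<lambda>x. 0, k) = torus_integral (\<lambda>x. \<psi> x * k x)"
        using metric_eq[OF u \<psi>] by simp
      moreover have "metric \<mu> u w (\<lambda>x. 0, k) = torus_integral (\<lambda>x. dm u x * k x)"
        using grad h DERIV_unique var[OF h] by (fastforce simp: is_metric_gradient_def)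
      ultimately show "torus_integral (\<lambda>x. \<psi> x * k x) = torus_integral (\<lambda>x. dm u x * k x)"
        by simp
    qed (use \<psi> dm in \<open>auto simp: potential_def\<close>)
    then show "w = onsager \<mu> u (dr u, dm u)"
      using \<psi> w(2) by (simp add: prod_eq_iff onsager_def potential_def weighted_laplacian_def)
  }
qed

end

lemma flux_gradient_flow_iff_dissipative_system:
  assumes "first_variations c1 c2 E dr dm" "admissible_flux c1 c2 dr dm f1 f2"
  shows "flux_gradient_flow c1 c2 \<mu> E dr dm f1 f2 I r m \<longleftrightarrow> dissipative_system \<mu> dm f1 f2 I r m"
  using assms
  by (simp add: flux_gradient_flow_def dissipative_system_def onsager_def weighted_laplacian_def Let_def)

section \<open>The chain rule along curves of states\<close>

lemma shift_state_spaceI: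
  assumes "u \<in> state_space c1 c2" "h \<in> tangent_space" "\<And>x. fst u x + s * fst h x > 0"
  shows "shift u h s \<in> state_space c1 c2"
  using assms(3) state_spaceD[OF assms(1)] tangent_spaceD[OF assms(2)]
  by (auto simp: shift_def state_space_def torus_integral_add smooth_torus_cmult torus_integral_cmult
      intro!: smooth_torus_add)

lemma eventually_shift_state_space:
  assumes u: "u \<in> state_space c1 c2" and h: "h \<in> tangent_space"
  shows "\<forall>\<^sub>F s in nhds 0. shift u h s \<in> state_space c1 c2"
proof -
  obtain e where e: "e > 0" "\<And>x. fst u x \<ge> e"
    using smooth_torus_lower_bound state_spaceD[OF u] by metis
  obtain M where M: "M > 0" "\<And>x. \<bar>fst h x\<bar> \<le> M"
    using smooth_torus_bounded tangent_spaceD(1)[OF h] by metis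
  have "shift u h s \<in> state_space c1 c2" if s: "\<bar>s\<bar> < e / M" for s
  proof (rule shift_state_spaceI[OF u h])
    fix x
    have "\<bar>s * fst h x\<bar> \<le> \<bar>s\<bar> * M"
      unfolding abs_mult by (intro mult_left_mono M) auto
    also have "\<dots> < e"
      using s M by (simp add: field_simps)
    finally show "fst u x + s * fst h x > 0"
      using e(2)[of x] by linarith
  qed
  moreover have "e / M > 0"
    using e M by simp
  ultimately show ?thesis
    unfolding eventually_nhds_metric dist_real_def by auto
qed

lemma shift_segment_state_space:
  assumes u: "u \<in> state_space c1 c2" and h: "h \<in> tangent_space"
    and end1: "shift u h d \<in> state_space c1 c2" and s: "0 \<le> s" "s \<le> 1"
  shows "shift u h (s * d) \<in> state_space c1 c2"
proof (rule shift_state_spaceI[OF u h])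
  fix x
  have *: "fst u x > 0" "fst u x + d * fst h x > 0"
    using state_spaceD(3)[OF u, of x] state_spaceD(3)[OF end1, of x] by (auto simp: shift_def)
  have "fst u x + s * d * fst h x = (1 - s) * fst u x + s * (fst u x + d * fst h x)"
    by (simp add: algebra_simps)
  also have "\<dots> > 0"
  proof (cases "s = 0")
    case False
    then show ?thesis
      using s * by (intro add_nonneg_pos[OF mult_nonneg_nonneg mult_pos_pos]) auto
  qed (use * in simp)
  finally show "fst u x + s * d * fst h x > 0" .
qed

lemma shift_shift: "shift (shift u h s) h r = shift u h (r + s)"
  by (simp add: shift_def algebra_simps)

lemma shift_zero [simp]: "shift u h 0 = u"
  by (simp add: shift_def)

lemma smooth_functional_directional_derivative:
  assumes "smooth_functional c1 c2 E"
  shows "\<exists>G. (\<forall>u\<in>state_space c1 c2. \<forall>h\<in>tangent_space.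
      ((\<lambda>s. E (shift u h s)) has_real_derivative G h u) (at 0)) \<and>
    (\<forall>U u H h. (\<forall>n. U n \<in> state_space c1 c2) \<and> u \<in> state_space c1 c2 \<and>
      (\<forall>n. H n \<in> tangent_space) \<and> h \<in> tangent_space \<and> state_conv U u \<and> state_conv H h \<longrightarrow>
      (\<lambda>n. G (H n) (U n)) \<longlonglongrightarrow> G h u)"
proof -
  obtain D where D0: "\<forall>u \<in> state_space c1 c2. D [] u = E u"
    and D: "\<forall>u \<in> state_space c1 c2. \<forall>h \<in> tangent_space. \<forall>hs. set hs \<subseteq> tangent_space \<longrightarrow>
           ((\<lambda>s. D hs (shift u h s)) has_real_derivative D (h # hs) u) (at 0)"
    and cont: "\<forall>U u H hs.
           (\<forall>n. U n \<in> state_space c1 c2) \<and> u \<in> state_space c1 c2 \<and>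
           (\<forall>n. set (H n) \<subseteq> tangent_space \<and> length (H n) = length hs) \<and>
           set hs \<subseteq> tangent_space \<and>
           state_conv U u \<and> (\<forall>i < length hs. state_conv (\<lambda>n. H n ! i) (hs ! i)) \<longrightarrow>
           (\<lambda>n. D (H n) (U n)) \<longlonglongrightarrow> D hs u"
    using assms unfolding smooth_functional_def by (elim exE conjE)
  show ?thesis
  proof (rule exI[of _ "\<lambda>h. D [h]"], intro conjI ballI allI impI)
    fix u h assume u: "u \<in> state_space c1 c2" and h: "h \<in> tangent_space"
    have "\<forall>\<^sub>F s in nhds 0. D [] (shift u h s) = E (shift u h s)"
      using eventually_shift_state_space[OF u h] by eventually_elim (use D0 in blast)
    then show "((\<lambda>s. E (shift u h s)) has_real_derivative D [h] u) (at 0)"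
      using D[rule_format, OF u h, of "[]"] DERIV_cong_ev[OF refl _ refl] by force
  next
    fix U u H h
    assume "(\<forall>n. U n \<in> state_space c1 c2) \<and> u \<in> state_space c1 c2 \<and>
      (\<forall>n. H n \<in> tangent_space) \<and> h \<in> tangent_space \<and> state_conv U u \<and> state_conv H h"
    then show "(\<lambda>n. D [H n] (U n)) \<longlonglongrightarrow> D [h] u"
      by (intro cont[rule_format]) auto
  qed
qed

lemma smooth_conv_add_null:
  assumes f: "f \<in> smooth_torus" and g: "\<And>n. g n \<in> smooth_torus" "g0 \<in> smooth_torus"
    and conv: "smooth_conv g g0" and c: "c \<longlonglongrightarrow> 0"
  shows "smooth_conv (\<lambda>n x. f x + c n * g n x) f"
  unfolding smooth_conv_def
proof
  fix k
  obtain M where "\<And>x. \<bar>(deriv ^^ k) g0 x\<bar> \<le> M"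
    using smooth_torus_bounded smooth_torus_higher_deriv[OF g(2)] by metis
  then have bdd: "bounded (range ((deriv ^^ k) g0))"
    unfolding bounded_iff by auto
  have null: "uniform_limit UNIV (\<lambda>n x. c n) (\<lambda>x::real. 0) sequentially"
    using c unfolding uniform_limit_iff tendsto_iff by auto
  have "uniform_limit UNIV (\<lambda>n x. (deriv ^^ k) f x + c n * (deriv ^^ k) (g n) x)
      (\<lambda>x. (deriv ^^ k) f x + 0 * (deriv ^^ k) g0 x) sequentially"
    using conv bdd unfolding smooth_conv_def
    by (intro uniform_limit_add uniform_limit_const uniform_lim_mult null) auto
  then show "uniform_limit UNIV (\<lambda>n. (deriv ^^ k) (\<lambda>x. f x + c n * g n x)) ((deriv ^^ k) f) sequentially"
    by (simp add: higher_deriv_add_cmult f g smooth_torusD)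
qed

definition difference_quotient :: "(real \<Rightarrow> torus_fun) \<Rightarrow> real \<Rightarrow> real \<Rightarrow> torus_fun" where
  "difference_quotient f t s = (\<lambda>x. inverse (s - t) * (f s x - f t x))"

lemma smooth_functional_chain_rule:
  fixes r m :: "real \<Rightarrow> torus_fun"
  assumes E: "smooth_functional c1 c2 E" and fv: "first_variations c1 c2 E dr dm"
    and t: "t \<in> I" and state: "\<And>s. s \<in> I \<Longrightarrow> (r s, m s) \<in> state_space c1 c2"
    and V: "(v, w) \<in> tangent_space"
    and conv: "\<And>\<sigma>. \<lbrakk>\<And>n. \<sigma> n \<in> I - {t}; \<sigma> \<longlonglongrightarrow> t\<rbrakk> \<Longrightarrow>
      smooth_conv (\<lambda>n. difference_quotient r t (\<sigma> n)) v \<and>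
      smooth_conv (\<lambda>n. difference_quotient m t (\<sigma> n)) w"
  shows "((\<lambda>s. E (r s, m s)) has_real_derivative
    torus_integral (\<lambda>x. dr (r t, m t) x * v x + dm (r t, m t) x * w x)) (at t within I)"
proof -
  obtain G where G: "\<forall>u\<in>state_space c1 c2. \<forall>h\<in>tangent_space.
      ((\<lambda>s. E (shift u h s)) has_real_derivative G h u) (at 0)"
    and Gcont: "\<forall>U u H h. (\<forall>n. U n \<in> state_space c1 c2) \<and> u \<in> state_space c1 c2 \<and>
      (\<forall>n. H n \<in> tangent_space) \<and> h \<in> tangent_space \<and> state_conv U u \<and> state_conv H h \<longrightarrow>
      (\<lambda>n. G (H n) (U n)) \<longlonglongrightarrow> G h u"
    using smooth_functional_directional_derivative[OF E] by (elim exE conjE)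
  let ?u = "(r t, m t)"
  note u = state[OF t]
  have G_eq: "G (v, w) ?u = torus_integral (\<lambda>x. dr ?u x * v x + dm ?u x * w x)"
    using DERIV_unique[OF G[rule_format, OF u V] first_variationsD(3)[OF fv u V]] by simp
  have "((\<lambda>s. (E (r s, m s) - E ?u) / (s - t)) \<longlongrightarrow> G (v, w) ?u) (at t within I)"
    unfolding tendsto_at_iff_sequentially
  proof (intro allI impI)
    fix \<sigma> assume \<sigma>: "\<forall>n. \<sigma> n \<in> I - {t}" "\<sigma> \<longlonglongrightarrow> t"
    define d where "d = (\<lambda>n. \<sigma> n - t)"
    define q where "q n = (difference_quotient r t (\<sigma> n), difference_quotient m t (\<sigma> n))" for n
    have d: "d n \<noteq> 0" "d \<longlonglongrightarrow> 0" for n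
      using \<sigma> LIM_zero[OF \<sigma>(2)] by (auto simp: d_def)
    have r: "r (\<sigma> n) \<in> smooth_torus" "m (\<sigma> n) \<in> smooth_torus"
      "torus_integral (r (\<sigma> n)) = c1" "torus_integral (m (\<sigma> n)) = c2" for n
      using state_spaceD[OF state[of "\<sigma> n"]] \<sigma>(1) by auto
    have q: "q n \<in> tangent_space" for n
      using r state_spaceD[OF u]
      by (auto simp: q_def difference_quotient_def tangent_space_def torus_integral_cmult
          torus_integral_diff intro!: smooth_torus_intros)
    have end1: "shift ?u (q n) (d n) = (r (\<sigma> n), m (\<sigma> n))" for n
      using d(1)[of n] by (simp add: shift_def q_def difference_quotient_def d_def flip: mult.assoc)
    have "\<exists>\<theta>. \<bar>\<theta>\<bar> \<le> \<bar>d n\<bar> \<and> shift ?u (q n) \<theta> \<in> state_space c1 c2 \<and>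
        (E (r (\<sigma> n), m (\<sigma> n)) - E ?u) / d n = G (q n) (shift ?u (q n) \<theta>)" for n
    proof -
      have mem: "shift ?u (q n) (s * d n) \<in> state_space c1 c2" if "0 \<le> s" "s \<le> 1" for s
        using \<sigma>(1) state that by (intro shift_segment_state_space[OF u q]) (auto simp: end1)
      have deriv: "((\<lambda>s. E (shift ?u (q n) (s * d n))) has_real_derivative
          G (q n) (shift ?u (q n) (s * d n)) * d n) (at s)" if "0 \<le> s" "s \<le> 1" for s
      proof -
        have "((\<lambda>y. E (shift ?u (q n) (y + s * d n))) has_real_derivative
            G (q n) (shift ?u (q n) (s * d n))) (at 0)"
          using G[rule_format, OF mem[OF that] q[of n]] by (simp only: shift_shift)
        then have "((\<lambda>y. E (shift ?u (q n) y)) has_real_derivative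
            G (q n) (shift ?u (q n) (s * d n))) (at (s * d n))"
          using DERIV_shift[of "\<lambda>y. E (shift ?u (q n) y)" _ 0 "s * d n"] by simp
        moreover have "((\<lambda>s. s * d n) has_real_derivative d n) (at s)"
          by (auto intro!: derivative_eq_intros)
        ultimately show ?thesis
          by (rule DERIV_chain2)
      qed
      obtain s where s: "0 < s" "s < 1"
        "E (shift ?u (q n) (1 * d n)) - E (shift ?u (q n) (0 * d n)) =
          (1 - 0) * (G (q n) (shift ?u (q n) (s * d n)) * d n)"
        using MVT2[of 0 1, OF _ deriv] by auto
      then have "(E (r (\<sigma> n), m (\<sigma> n)) - E ?u) / d n = G (q n) (shift ?u (q n) (s * d n))"
        using d(1)[of n] by (simp add: end1)
      moreover have "\<bar>s * d n\<bar> \<le> \<bar>d n\<bar>"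
        using s by (simp add: abs_mult mult_left_le_one_le)
      ultimately show ?thesis
        using mem[of s] s by auto
    qed
    then obtain \<theta> where \<theta>: "\<And>n. \<bar>\<theta> n\<bar> \<le> \<bar>d n\<bar>" "\<And>n. shift ?u (q n) (\<theta> n) \<in> state_space c1 c2"
      "\<And>n. (E (r (\<sigma> n), m (\<sigma> n)) - E ?u) / d n = G (q n) (shift ?u (q n) (\<theta> n))"
      by metis
    have "\<theta> \<longlonglongrightarrow> 0"
      using \<theta>(1) tendsto_rabs_zero[OF d(2)] by (intro Lim_null_comparison[of \<theta> "\<lambda>n. \<bar>d n\<bar>"]) auto
    moreover have q_conv: "state_conv q (v, w)"
      using conv[of \<sigma>] \<sigma> by (simp add: state_conv_def q_def)
    ultimately have "state_conv (\<lambda>n. shift ?u (q n) (\<theta> n)) ?u"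
      using state_spaceD(1,2)[OF u] tangent_spaceD(1,2)[OF q] tangent_spaceD(1,2)[OF V]
      unfolding state_conv_def shift_def fst_conv snd_conv
      by (intro conjI smooth_conv_add_null[of _ _ v] smooth_conv_add_null[of _ _ w]) auto
    then have "(\<lambda>n. G (q n) (shift ?u (q n) (\<theta> n))) \<longlonglongrightarrow> G (v, w) ?u"
      using \<theta>(2) u q V q_conv by (intro Gcont[rule_format] conjI allI)
    then show "((\<lambda>s. (E (r s, m s) - E ?u) / (s - t)) \<circ> \<sigma>) \<longlonglongrightarrow> G (v, w) ?u"
      by (simp add: o_def \<theta>(3)[symmetric] d_def)
  qed
  then show ?thesis
    by (simp add: has_field_derivative_iff G_eq)
qed

section \<open>Smooth evolutions\<close>

lemma smooth_in_spacetime_higher_deriv: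
  assumes "smooth_in_spacetime I f"
  shows "\<exists>g. smooth_in_spacetime I g \<and> (\<forall>t\<in>I. (deriv ^^ k) (f t) = g t)"
proof (induction k)
  case 0
  then show ?case using assms by auto
next
  case (Suc k)
  then obtain g where g: "smooth_in_spacetime I g" "\<forall>t\<in>I. (deriv ^^ k) (f t) = g t"
    by blast
  from g(1) obtain gx where "smooth_in_spacetime I gx"
    "\<And>t x. t \<in> I \<Longrightarrow> ((\<lambda>y. g t y) has_real_derivative gx t x) (at x)"
    by cases blast
  moreover from this have "(deriv ^^ Suc k) (f t) = gx t" if "t \<in> I" for t
    using g(2) that by (auto intro!: DERIV_imp_deriv)
  ultimately show ?case by blast
qed

lemma uniform_limit_difference_quotient:
  fixes g gt :: "real \<Rightarrow> torus_fun"
  assumes I: "is_interval I" and t: "t \<in> I"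
    and cont: "continuous_on (I \<times> UNIV) (\<lambda>(s, x). gt s x)"
    and der: "\<And>s x. s \<in> I \<Longrightarrow> ((\<lambda>s. g s x) has_real_derivative gt s x) (at s within I)"
    and per: "\<And>s x. s \<in> I \<Longrightarrow> g s (x + 1) = g s x"
    and \<sigma>: "\<And>n. \<sigma> n \<in> I - {t}" "\<sigma> \<longlonglongrightarrow> t"
  shows "uniform_limit UNIV (\<lambda>n. difference_quotient g t (\<sigma> n)) (gt t) sequentially"
proof -
  let ?q = "\<lambda>n. difference_quotient g t (\<sigma> n)"
  have unit: "uniform_limit {0..1} ?q (gt t) sequentially"
  proof (rule uniform_limitI)
    fix e :: real assume "e > 0"
    have "continuous_on (I \<times> {0..1}) (\<lambda>(s, x). gt s x)"
      using cont by (rule continuous_on_subset) auto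
    then obtain X where X: "t \<in> X" "open X"
      "\<forall>s\<in>X \<inter> I. \<forall>x\<in>{0..1}. dist (gt s x) (gt t x) \<le> e / 2"
      using continuous_on_prod_compactE[OF _ compact_Icc t, of 0 1 "\<lambda>(s, x). gt s x" "e / 2"] \<open>e > 0\<close>
      by (auto simp: split_beta)
    then obtain d where d: "d > 0" "ball t d \<subseteq> X"
      by (meson open_contains_ball)
    have "\<forall>\<^sub>F n in sequentially. dist (\<sigma> n) t < d"
      using \<sigma>(2) d(1) by (rule tendstoD)
    then show "\<forall>\<^sub>F n in sequentially. \<forall>x\<in>{0..1}. dist (?q n x) (gt t x) < e"
    proof eventually_elim
      case (elim n)
      show ?case
      proof
        fix x :: real assume x: "x \<in> {0..1}"
        let ?a = "min t (\<sigma> n)" and ?b = "max t (\<sigma> n)"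
        have "?a \<in> I" "?b \<in> I"
          using t \<sigma>(1)[of n] by (auto simp: min_def max_def)
        then have sub: "{?a..?b} \<subseteq> I"
          using mem_is_interval_1_I[OF I] by (meson atLeastAtMost_iff subsetI)
        have "((\<lambda>s. g s x) has_derivative (*) (gt \<xi> x)) (at \<xi> within {?a..?b})" if "\<xi> \<in> {?a..?b}" for \<xi>
          using DERIV_subset[OF der sub, of \<xi> x] that sub by (auto simp: has_field_derivative_def)
        then have "\<exists>\<xi>\<in>{?a..?b}. g ?b x - g ?a x = gt \<xi> x * (?b - ?a)"
          by (intro mvt_very_simple) auto
        then obtain \<xi> where \<xi>: "\<xi> \<in> {?a..?b}" "g ?b x - g ?a x = gt \<xi> x * (?b - ?a)"
          by blast
        have "g (\<sigma> n) x - g t x = gt \<xi> x * (\<sigma> n - t)"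
          using \<xi>(2) by (cases "t \<le> \<sigma> n") (auto simp: algebra_simps)
        then have "?q n x = gt \<xi> x"
          using \<sigma>(1)[of n] by (simp add: difference_quotient_def)
        moreover have "\<xi> \<in> ball t d"
          using \<xi>(1) elim by (auto simp: dist_real_def)
        then have "dist (gt \<xi> x) (gt t x) \<le> e / 2"
          using X(3) d(2) sub \<xi>(1) x by blast
        ultimately show "dist (?q n x) (gt t x) < e"
          using \<open>e > 0\<close> by simp
      qed
    qed
  qed
  have "t islimpt I"
    using \<sigma> unfolding islimpt_sequential by blast
  then have nontriv: "at t within I \<noteq> bot"
    by (simp add: trivial_limit_within)
  have gt_per: "gt t (x + 1) = gt t x" for x
  proof -
    have "((\<lambda>s. g s (x + 1)) has_real_derivative gt t x) (at t within I)"
      by (rule has_field_derivative_transform_within[OF der[OF t] zero_less_one t]) (simp add: per)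
    then show ?thesis
      using vector_derivative_unique_within[OF nontriv] der[OF t, of "x + 1"]
      unfolding has_real_derivative_iff_has_vector_derivative by blast
  qed
  have "uniform_limit UNIV (\<lambda>n x. ?q n (frac x)) (\<lambda>x. gt t (frac x)) sequentially"
    by (rule uniform_limit_compose'[OF unit]) (use frac_in_unit in auto)
  moreover have "?q n (frac x) = ?q n x" for n x
    using \<sigma>(1)[of n] t by (intro periodic_frac) (simp add: difference_quotient_def per)
  ultimately show ?thesis
    by (simp add: periodic_frac[of "gt t", OF gt_per])
qed

lemma smooth_conv_if_uniform_limits:
  assumes smooth: "\<And>n. smooth_on UNIV (F n)"
    and lim: "\<And>k. uniform_limit UNIV (\<lambda>n. (deriv ^^ k) (F n)) (G k) sequentially"
  shows "smooth_conv F (G 0)"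
proof -
  have deriv: "(G k has_real_derivative G (Suc k) x) (at x)" for k x
  proof -
    let ?f = "\<lambda>n. (deriv ^^ k) (F n)"
    have pt: "(\<lambda>n. ?f n y) \<longlonglongrightarrow> G k y" for y
      using tendsto_uniform_limitI[OF lim[of k]] by simp
    have der: "(?f n has_derivative (\<lambda>h. (deriv ^^ Suc k) (F n) y * h)) (at y)" for n y
      using smooth_on_has_deriv[OF smooth_on_higher_deriv[OF smooth]]
      by (simp add: has_field_derivative_def)
    have bound: "\<forall>\<^sub>F n in sequentially. \<forall>y\<in>UNIV. \<forall>h.
        norm ((deriv ^^ Suc k) (F n) y * h - G (Suc k) y * h) \<le> e * norm h" if "e > 0" for e
      using uniform_limitD[OF lim[of "Suc k"] that]
    proof eventually_elim
      case (elim n)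
      show ?case
      proof (intro ballI allI)
        fix y h
        show "norm ((deriv ^^ Suc k) (F n) y * h - G (Suc k) y * h) \<le> e * norm h"
          using elim by (auto simp: dist_real_def abs_mult less_imp_le simp flip: left_diff_distrib
              simp del: funpow.simps intro!: mult_right_mono)
      qed
    qed
    obtain g where "\<forall>y. (\<lambda>n. ?f n y) \<longlonglongrightarrow> g y \<and> (g has_derivative (*) (G (Suc k) y)) (at y)"
      using has_derivative_sequence[OF convex_UNIV der bound UNIV_I pt] by auto
    moreover from this have "g = G k"
      using pt LIMSEQ_unique by blast
    ultimately show ?thesis
      by (simp add: has_field_derivative_def)
  qed
  have "(deriv ^^ k) (G 0) = G k" for k
    by (induction k) (auto intro!: DERIV_imp_deriv deriv)
  then show ?thesis
    using lim by (simp add: smooth_conv_def)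
qed

lemma smooth_conv_difference_quotient:
  assumes I: "is_interval I" and t: "t \<in> I"
    and f: "smooth_in_spacetime I f" and torus: "\<And>s. s \<in> I \<Longrightarrow> f s \<in> smooth_torus"
    and \<sigma>: "\<And>n. \<sigma> n \<in> I - {t}" "\<sigma> \<longlonglongrightarrow> t"
  shows "smooth_conv (\<lambda>n. difference_quotient f t (\<sigma> n)) (time_deriv I f t)"
proof -
  let ?q = "\<lambda>n. difference_quotient f t (\<sigma> n)"
  have q: "(deriv ^^ k) (?q n) = difference_quotient (\<lambda>s. (deriv ^^ k) (f s)) t (\<sigma> n)" for k n
    using \<sigma>(1)[of n] t torus unfolding difference_quotient_def
    by (intro higher_deriv_cmult_diff) (auto intro: smooth_torusD)
  have "\<exists>v. uniform_limit UNIV (\<lambda>n. (deriv ^^ k) (?q n)) v sequentially" for k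
  proof -
    obtain g where g: "smooth_in_spacetime I g" "\<forall>t\<in>I. (deriv ^^ k) (f t) = g t"
      using smooth_in_spacetime_higher_deriv[OF f] by blast
    from g(1) obtain gt where gt: "smooth_in_spacetime I gt"
      "\<And>t x. t \<in> I \<Longrightarrow> ((\<lambda>s. g s x) has_real_derivative gt t x) (at t within I)"
      by cases blast
    have cont: "continuous_on (I \<times> UNIV) (\<lambda>(t, x). gt t x)"
      using gt(1) by cases
    have per: "g s (x + 1) = g s x" if "s \<in> I" for s x
      using smooth_torus_periodic[OF smooth_torus_higher_deriv[OF torus[OF that]]] g(2) that by metis
    have "uniform_limit UNIV (\<lambda>n. difference_quotient g t (\<sigma> n)) (gt t) sequentially"
      by (rule uniform_limit_difference_quotient[where I=I and g=g and gt=gt])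
        (use I t cont gt(2) per \<sigma> in blast)+
    moreover have "(deriv ^^ k) (?q n) = difference_quotient g t (\<sigma> n)" for n
      unfolding q using g(2) t \<sigma>(1)[of n] by (simp add: difference_quotient_def)
    ultimately show ?thesis by auto
  qed
  then obtain G where G: "\<And>k. uniform_limit UNIV (\<lambda>n. (deriv ^^ k) (?q n)) (G k) sequentially"
    by metis
  have "?q n \<in> smooth_torus" for n
    using torus t \<sigma>(1)[of n] unfolding difference_quotient_def
    by (intro smooth_torus_cmult smooth_torus_diff) auto
  then have "smooth_conv ?q (G 0)"
    by (intro smooth_conv_if_uniform_limits G smooth_torusD)
  moreover have "time_deriv I f t x = G 0 x" for x
  proof -
    from f obtain ft where ft: "((\<lambda>s. f s x) has_real_derivative ft t x) (at t within I)"
      by cases (use t in blast)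
    have "t islimpt I"
      using \<sigma> unfolding islimpt_sequential by blast
    then have "time_deriv I f t x = ft t x"
      using ft unfolding time_deriv_def has_real_derivative_iff_has_vector_derivative
      by (intro vector_derivative_within) (auto simp: trivial_limit_within)
    moreover have "(\<lambda>n. ?q n x) \<longlonglongrightarrow> ft t x"
    proof -
      have "((\<lambda>s. (f s x - f t x) / (s - t)) \<circ> \<sigma>) \<longlonglongrightarrow> ft t x"
        using ft \<sigma> unfolding has_field_derivative_iff tendsto_at_iff_sequentially by blast
      then show ?thesis
        by (simp add: o_def difference_quotient_def divide_inverse mult.commute)
    qed
    moreover have "(\<lambda>n. ?q n x) \<longlonglongrightarrow> G 0 x"
      using tendsto_uniform_limitI[OF G[of 0]] by simp
    ultimately show ?thesis
      using LIMSEQ_unique by metis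
  qed
  ultimately show ?thesis
    by (metis ext)
qed

lemma dissipation_identity:
  assumes smooth: "smooth_on {0<..} \<mu>" and pos: "\<And>s. s > 0 \<Longrightarrow> \<mu> s > 0"
    and E: "smooth_functional c1 c2 E" and fv: "first_variations c1 c2 E dr dm"
    and flux: "admissible_flux c1 c2 dr dm f1 f2"
    and ev: "smooth_evolution c1 c2 I r m" and sys: "dissipative_system \<mu> dm f1 f2 I r m"
    and t: "t \<in> I"
  shows "((\<lambda>s. E (r s, m s)) has_real_derivative
    - torus_integral (\<lambda>x. \<bar>deriv (dm (r t, m t)) x\<bar>\<^sup>2 * \<mu> (r t x))) (at t within I)"
proof -
  define u where "u = (r t, m t)"
  have u: "u \<in> state_space c1 c2"
    using ev t by (simp add: smooth_evolution_def u_def)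
  define J where "J = (\<lambda>x. \<mu> (r t x) * deriv (dm u) x)"
  have J: "J \<in> smooth_torus"
    using smooth_torus_weighted_deriv[OF smooth pos u first_variationsD(2)[OF fv u]]
    by (simp add: J_def u_def)
  have f: "f1 u \<in> smooth_torus" "f2 u \<in> smooth_torus"
    and orth: "torus_integral (\<lambda>x. f1 u x * deriv (dr u) x + f2 u x * deriv (dm u) x) = 0"
    using flux u by (auto simp: admissible_flux_def)
  note d = first_variationsD(1,2)[OF fv u]
  define v where "v = time_deriv I r t"
  define w where "w = time_deriv I m t"
  have v: "v = (\<lambda>x. - deriv (f1 u) x)" and w: "w = (\<lambda>x. deriv J x - deriv (f2 u) x)"
    using sys t by (auto simp: dissipative_system_def v_def w_def u_def J_def algebra_simps
        add_eq_0_iff2)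
  have V: "(v, w) \<in> tangent_space"
    using f J by (auto simp: v w tangent_space_def torus_integral_minus torus_integral_diff
        torus_integral_deriv smooth_torus_deriv intro!: smooth_torus_intros)
  have state: "\<And>s. s \<in> I \<Longrightarrow> (r s, m s) \<in> state_space c1 c2"
    and I: "is_interval I" and rm: "smooth_in_spacetime I r" "smooth_in_spacetime I m"
    using ev by (auto simp: smooth_evolution_def)
  have torus: "r s \<in> smooth_torus" "m s \<in> smooth_torus" if "s \<in> I" for s
    using state_spaceD(1,2)[OF state[OF that]] by auto
  have "((\<lambda>s. E (r s, m s)) has_real_derivative
      torus_integral (\<lambda>x. dr (r t, m t) x * v x + dm (r t, m t) x * w x)) (at t within I)"
    using smooth_conv_difference_quotient[OF I t rm(1) torus(1)]
      smooth_conv_difference_quotient[OF I t rm(2) torus(2)]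
    by (intro smooth_functional_chain_rule[OF E fv t state V]) (auto simp: v_def w_def)
  moreover have "torus_integral (\<lambda>x. dr u x * v x + dm u x * w x) =
      - torus_integral (\<lambda>x. \<bar>deriv (dm u) x\<bar>\<^sup>2 * \<mu> (r t x))"
  proof -
    have "torus_integral (\<lambda>x. dr u x * v x + dm u x * w x) =
        torus_integral (\<lambda>x. dm u x * deriv J x - (dr u x * deriv (f1 u) x + dm u x * deriv (f2 u) x))"
      by (simp add: v w algebra_simps)
    also have "\<dots> = torus_integral (\<lambda>x. dm u x * deriv J x) -
        (torus_integral (\<lambda>x. dr u x * deriv (f1 u) x) + torus_integral (\<lambda>x. dm u x * deriv (f2 u) x))"
      using d f J by (simp add: torus_integral_add torus_integral_diff smooth_torus_intros)
    also have "\<dots> = - torus_integral (\<lambda>x. deriv (dm u) x * J x) +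
        torus_integral (\<lambda>x. deriv (dr u) x * f1 u x + deriv (dm u) x * f2 u x)"
      using d f J by (simp add: torus_integral_by_parts torus_integral_add smooth_torus_intros)
    also have "\<dots> = - torus_integral (\<lambda>x. deriv (dm u) x * J x)"
      using orth by (simp add: mult.commute)
    finally show ?thesis
      by (simp add: J_def power2_eq_square mult_ac)
  qed
  ultimately show ?thesis
    by (simp add: u_def)
qed

section \<open>Derivatives of the barotropic energy\<close>

primrec coeff0 :: "state list \<Rightarrow> torus_fun" where
  "coeff0 [] = (\<lambda>x. 1)"
| "coeff0 (h # hs) = (\<lambda>x. fst h x * coeff0 hs x)"

primrec coeff1 :: "state list \<Rightarrow> torus_fun" where
  "coeff1 [] = (\<lambda>x. 0)"
| "coeff1 (h # hs) = (\<lambda>x. fst h x * coeff1 hs x + snd h x * coeff0 hs x)"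

primrec coeff2 :: "state list \<Rightarrow> torus_fun" where
  "coeff2 [] = (\<lambda>x. 0)"
| "coeff2 (h # hs) = (\<lambda>x. fst h x * coeff2 hs x + 2 * snd h x * coeff1 hs x)"

lemma coeff2_eq_0: "length hs \<le> 1 \<Longrightarrow> coeff2 hs x = 0"
  by (cases hs) auto

lemma smooth_torus_coeffs:
  assumes "set hs \<subseteq> tangent_space"
  shows "coeff0 hs \<in> smooth_torus" "coeff1 hs \<in> smooth_torus" "coeff2 hs \<in> smooth_torus"
  using assms by (induction hs) (auto intro!: smooth_torus_intros simp: tangent_space_def)

text \<open>The derivative of \<open>m\<^sup>2 q(\<rho>) + p(\<rho>)\<close> in the directions \<open>hs\<close>. Since this is quadratic in \<open>m\<close>, each
  direction contributes its \<open>m\<close>-component to at most two factors, which gives the three coefficients.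
  The truncated subtractions are harmless because the coefficients vanish where they truncate.\<close>

definition density_deriv :: "(real \<Rightarrow> real) \<Rightarrow> (real \<Rightarrow> real) \<Rightarrow> state list \<Rightarrow> state \<Rightarrow> torus_fun" where
  "density_deriv q p hs u = (\<lambda>x.
     (snd u x)\<^sup>2 * ((deriv ^^ length hs) q (fst u x) * coeff0 hs x) +
     2 * (snd u x * ((deriv ^^ (length hs - 1)) q (fst u x) * coeff1 hs x)) +
     (deriv ^^ (length hs - 2)) q (fst u x) * coeff2 hs x +
     (deriv ^^ length hs) p (fst u x) * coeff0 hs x)"

lemma has_deriv_higher_deriv_affine:
  assumes "smooth_on {0<..} f" "a + s * b > 0"
  shows "((\<lambda>s. (deriv ^^ k) f (a + s * b)) has_real_derivative (deriv ^^ Suc k) f (a + s * b) * b) (at s)"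
proof -
  have "((deriv ^^ k) f has_real_derivative (deriv ^^ Suc k) f (a + s * b)) (at (a + s * b))"
    using smooth_on_has_deriv[OF smooth_on_higher_deriv[OF assms(1)]] assms(2) by simp
  moreover have "((\<lambda>s. a + s * b) has_real_derivative b) (at s)"
    by (auto intro!: derivative_eq_intros)
  ultimately show ?thesis
    by (rule DERIV_chain2)
qed

lemma density_deriv_step:
  assumes q: "smooth_on {0<..} q" and p: "smooth_on {0<..} p" and pos: "fst u x + s * fst h x > 0"
  shows "((\<lambda>s. density_deriv q p hs (shift u h s) x) has_real_derivative
    density_deriv q p (h # hs) (shift u h s) x) (at s)"
proof -
  let ?k = "length hs" and ?r = "fst u x + s * fst h x" and ?m = "snd u x + s * snd h x"
  have m: "((\<lambda>s. snd u x + s * snd h x) has_real_derivative snd h x) (at s)"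
    by (auto intro!: derivative_eq_intros)
  have c1: "(deriv ^^ Suc (?k - 1)) q ?r * coeff1 hs x = (deriv ^^ ?k) q ?r * coeff1 hs x"
    by (cases "?k = 0") auto
  have c2: "(deriv ^^ Suc (?k - 2)) q ?r * coeff2 hs x = (deriv ^^ (?k - 1)) q ?r * coeff2 hs x"
  proof (cases "?k \<le> 1")
    case False
    then have "Suc (?k - 2) = ?k - 1" by simp
    then show ?thesis by (simp only:)
  qed (simp add: coeff2_eq_0)
  have "((\<lambda>s. density_deriv q p hs (shift u h s) x) has_real_derivative
      (2 * ?m * snd h x * ((deriv ^^ ?k) q ?r * coeff0 hs x) +
        ?m\<^sup>2 * ((deriv ^^ Suc ?k) q ?r * fst h x * coeff0 hs x)) +
      2 * (snd h x * ((deriv ^^ (?k - 1)) q ?r * coeff1 hs x) +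
        ?m * (fst h x * ((deriv ^^ Suc (?k - 1)) q ?r * coeff1 hs x))) +
      fst h x * ((deriv ^^ Suc (?k - 2)) q ?r * coeff2 hs x) +
      (deriv ^^ Suc ?k) p ?r * fst h x * coeff0 hs x) (at s)"
    unfolding density_deriv_def shift_def fst_conv snd_conv
    by (rule derivative_eq_intros has_deriv_higher_deriv_affine[OF q pos]
        has_deriv_higher_deriv_affine[OF p pos] m refl)+ (simp add: algebra_simps del: funpow.simps)
  then show ?thesis
    unfolding c1 c2
    by (rule DERIV_cong) (simp add: density_deriv_def shift_def algebra_simps del: funpow.simps)
qed

lemma smooth_torus_density_deriv:
  assumes "smooth_on {0<..} q" "smooth_on {0<..} p" "u \<in> state_space c1 c2" "set hs \<subseteq> tangent_space"
  shows "density_deriv q p hs u \<in> smooth_torus"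
proof -
  have comp: "(\<lambda>x. (deriv ^^ k) f (fst u x)) \<in> smooth_torus" if "smooth_on {0<..} f" for f k
    using smooth_torus_compose[OF smooth_on_higher_deriv[OF that]] state_spaceD(1,3)[OF assms(3)] by simp
  show ?thesis
    unfolding density_deriv_def
    by (intro smooth_torus_add smooth_torus_cmult smooth_torus_mult smooth_torus_power comp
        smooth_torus_coeffs assms state_spaceD(2)[OF assms(3)])
qed

lemma smooth_torus_continuous_snd:
  fixes A :: "(real \<times> real) set"
  assumes "f \<in> smooth_torus"
  shows "continuous_on A (\<lambda>y. f (snd y))"
  by (rule continuous_on_compose2[OF smooth_torus_continuous[OF assms, of UNIV]])
    (auto intro: continuous_on_snd continuous_on_id)

lemma integral_density_deriv_step:
  assumes q: "smooth_on {0<..} q" and p: "smooth_on {0<..} p"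
    and u: "u \<in> state_space c1 c2" and h: "h \<in> tangent_space" and hs: "set hs \<subseteq> tangent_space"
  shows "((\<lambda>s. torus_integral (density_deriv q p hs (shift u h s))) has_real_derivative
    torus_integral (density_deriv q p (h # hs) u)) (at 0)"
proof -
  obtain d where "d > 0" and d: "\<And>s. dist s 0 < d \<Longrightarrow> shift u h s \<in> state_space c1 c2"
    using eventually_shift_state_space[OF u h] unfolding eventually_nhds_metric by blast
  let ?U = "ball 0 d"
  have pos: "fst u x + s * fst h x > 0" if "s \<in> ?U" for s x
    using state_spaceD(3)[OF d, of s x] that by (simp add: shift_def dist_commute)
  have cont: "continuous_on (?U \<times> cbox 0 1) (\<lambda>y. (deriv ^^ k) f (fst u (snd y) + fst y * fst h (snd y)))"
    if "smooth_on {0<..} f" for f k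
  proof (rule continuous_on_compose2[OF smooth_on_continuous[OF smooth_on_higher_deriv[OF that]]])
    show "continuous_on (?U \<times> cbox 0 1) (\<lambda>y. fst u (snd y) + fst y * fst h (snd y))"
      by (intro continuous_on_add continuous_on_mult continuous_on_fst continuous_on_id
          smooth_torus_continuous_snd state_spaceD(1)[OF u] tangent_spaceD(1)[OF h])
  qed (use pos in auto)
  have "continuous_on (?U \<times> cbox 0 1) (\<lambda>(s, x). density_deriv q p (h # hs) (shift u h s) x)"
    unfolding density_deriv_def split_beta shift_def fst_conv snd_conv coeff0.simps coeff1.simps coeff2.simps
    by (intro continuous_on_add continuous_on_mult continuous_on_power continuous_on_const continuous_on_fst
        continuous_on_id cont q p smooth_torus_continuous_snd state_spaceD(2)[OF u] tangent_spaceD(1,2)[OF h]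
        smooth_torus_coeffs[OF hs])
  then have "((\<lambda>s. integral (cbox 0 1) (density_deriv q p hs (shift u h s))) has_real_derivative
      integral (cbox 0 1) (density_deriv q p (h # hs) (shift u h 0))) (at 0 within ?U)"
    using \<open>d > 0\<close> pos d
    by (intro leibniz_rule_field_derivative)
      (auto intro!: DERIV_subset[OF density_deriv_step[OF q p]] integrable_continuous_interval
        smooth_torus_continuous smooth_torus_density_deriv[OF q p _ hs] simp: dist_commute)
  moreover have "at 0 within ?U = at (0 :: real)"
    using \<open>d > 0\<close> by (intro at_within_open) auto
  ultimately show ?thesis
    unfolding torus_integral_def shift_zero box_real by (simp only:)
qed

definition torus_lim :: "(nat \<Rightarrow> torus_fun) \<Rightarrow> torus_fun \<Rightarrow> bool" where
  "torus_lim F f \<longleftrightarrow> uniform_limit UNIV F f sequentially \<and> f \<in> smooth_torus"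

lemma torus_lim_const: "f \<in> smooth_torus \<Longrightarrow> torus_lim (\<lambda>n. f) f"
  by (simp add: torus_lim_def uniform_limit_const)

lemma torus_lim_add: "\<lbrakk>torus_lim F f; torus_lim G g\<rbrakk> \<Longrightarrow> torus_lim (\<lambda>n x. F n x + G n x) (\<lambda>x. f x + g x)"
  by (auto simp: torus_lim_def intro: uniform_limit_add smooth_torus_add)

lemma torus_lim_mult:
  assumes "torus_lim F f" "torus_lim G g"
  shows "torus_lim (\<lambda>n x. F n x * G n x) (\<lambda>x. f x * g x)"
proof -
  have "bounded (range f)" if "f \<in> smooth_torus" for f
    using smooth_torus_bounded[OF that] unfolding bounded_iff by (metis rangeE real_norm_def)
  then show ?thesis
    using assms by (auto simp: torus_lim_def intro: uniform_lim_mult smooth_torus_mult)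
qed

lemma torus_lim_if_smooth_conv:
  assumes "smooth_conv F f" "f \<in> smooth_torus"
  shows "torus_lim F f"
proof -
  have "uniform_limit UNIV (\<lambda>n. (deriv ^^ 0) (F n)) ((deriv ^^ 0) f) sequentially"
    using assms(1) unfolding smooth_conv_def by blast
  then show ?thesis
    using assms(2) by (simp add: torus_lim_def)
qed

lemma torus_lim_compose:
  assumes f: "smooth_on {0<..} f" and lim: "torus_lim R r" and pos: "\<And>x. r x > 0"
  shows "torus_lim (\<lambda>n x. f (R n x)) (\<lambda>x. f (r x))"
proof -
  have r: "r \<in> smooth_torus" and ul: "uniform_limit UNIV R r sequentially"
    using lim by (auto simp: torus_lim_def)
  obtain e where e: "e > 0" "\<And>x. r x \<ge> e"
    using smooth_torus_lower_bound[OF r pos] by blast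
  obtain M where M: "\<And>x. \<bar>r x\<bar> \<le> M"
    using smooth_torus_bounded[OF r] by blast
  have "continuous_on {e/2..M + e} f"
    using e(1) by (intro continuous_on_subset[OF smooth_on_continuous[OF f]]) auto
  then have uc: "uniformly_continuous_on {e/2..M + e} f"
    by (intro compact_uniformly_continuous) auto
  have "\<forall>\<^sub>F n in sequentially. \<forall>x\<in>UNIV. R n x \<in> {e/2..M + e}"
    using uniform_limitD[OF ul half_gt_zero[OF e(1)]]
  proof eventually_elim
    case (elim n)
    have "R n x \<in> {e/2..M + e}" for x
    proof -
      have "\<bar>R n x - r x\<bar> < e/2"
        using elim e(1) by (simp add: dist_real_def)
      then show ?thesis
        using e(2)[of x] M[of x] unfolding atLeastAtMost_iff abs_less_iff abs_le_iff by linarith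
    qed
    then show ?case by blast
  qed
  then have "uniform_limit UNIV (\<lambda>n x. f (R n x)) (\<lambda>x. f (r x)) sequentially"
    by (intro uniform_limit_compose_uniformly_continuous_on[OF ul uc]) auto
  moreover have "(\<lambda>x. f (r x)) \<in> smooth_torus"
    by (rule smooth_torus_compose[OF f r]) (simp add: pos)
  ultimately show ?thesis
    by (simp add: torus_lim_def)
qed

lemma torus_lim_coeffs:
  assumes "\<And>n. length (H n) = length hs" "set hs \<subseteq> tangent_space"
    "\<And>i. i < length hs \<Longrightarrow> state_conv (\<lambda>n. H n ! i) (hs ! i)"
  shows "torus_lim (\<lambda>n. coeff0 (H n)) (coeff0 hs) \<and> torus_lim (\<lambda>n. coeff1 (H n)) (coeff1 hs) \<and>
    torus_lim (\<lambda>n. coeff2 (H n)) (coeff2 hs)"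
  using assms
proof (induction hs arbitrary: H)
  case Nil
  then show ?case by (simp add: torus_lim_const smooth_torus_const)
next
  case (Cons h hs)
  have "H n = hd (H n) # tl (H n)" for n
    using Cons.prems(1)[of n] by (cases "H n") auto
  then have "H = (\<lambda>n. hd (H n) # tl (H n))"
    by (rule ext)
  then obtain K L where H: "H = (\<lambda>n. K n # L n)"
    by (rule that)
  have "state_conv K h"
    using Cons.prems(3)[of 0] by (simp add: H)
  then have h: "torus_lim (\<lambda>n. fst (K n)) (fst h)" "torus_lim (\<lambda>n. snd (K n)) (snd h)"
    using Cons.prems(2) by (auto simp: state_conv_def tangent_space_def intro!: torus_lim_if_smooth_conv)
  have "state_conv (\<lambda>n. L n ! i) (hs ! i)" if "i < length hs" for i
    using Cons.prems(3)[of "Suc i"] that by (simp add: H)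
  moreover have "length (L n) = length hs" for n
    using Cons.prems(1)[of n] by (simp add: H)
  ultimately have IH: "torus_lim (\<lambda>n. coeff0 (L n)) (coeff0 hs)" "torus_lim (\<lambda>n. coeff1 (L n)) (coeff1 hs)"
    "torus_lim (\<lambda>n. coeff2 (L n)) (coeff2 hs)"
    using Cons.IH[of L] Cons.prems(2) by auto
  have two: "torus_lim (\<lambda>n x. 2) (\<lambda>x. 2)"
    by (intro torus_lim_const smooth_torus_const)
  show ?case
    unfolding H coeff0.simps coeff1.simps coeff2.simps
    by (intro conjI torus_lim_add torus_lim_mult h IH two)
qed

lemma integral_density_deriv_tendsto:
  assumes q: "smooth_on {0<..} q" and p: "smooth_on {0<..} p"
    and U: "\<And>n. U n \<in> state_space c1 c2" "u \<in> state_space c1 c2" "state_conv U u"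
    and H: "\<And>n. set (H n) \<subseteq> tangent_space" "\<And>n. length (H n) = length hs" "set hs \<subseteq> tangent_space"
      "\<And>i. i < length hs \<Longrightarrow> state_conv (\<lambda>n. H n ! i) (hs ! i)"
  shows "(\<lambda>n. torus_integral (density_deriv q p (H n) (U n))) \<longlonglongrightarrow> torus_integral (density_deriv q p hs u)"
proof -
  have r: "torus_lim (\<lambda>n. fst (U n)) (fst u)" and m: "torus_lim (\<lambda>n. snd (U n)) (snd u)"
    using U(3) state_spaceD(1,2)[OF U(2)] by (auto simp: state_conv_def intro!: torus_lim_if_smooth_conv)
  have comp: "torus_lim (\<lambda>n x. (deriv ^^ k) f (fst (U n) x)) (\<lambda>x. (deriv ^^ k) f (fst u x))"
    if "smooth_on {0<..} f" for f k
    by (rule torus_lim_compose[OF smooth_on_higher_deriv[OF that] r]) (rule state_spaceD(3)[OF U(2)])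
  have two: "torus_lim (\<lambda>n x. 2) (\<lambda>x. 2)"
    by (intro torus_lim_const smooth_torus_const)
  have coeffs: "torus_lim (\<lambda>n. coeff0 (H n)) (coeff0 hs)" "torus_lim (\<lambda>n. coeff1 (H n)) (coeff1 hs)"
    "torus_lim (\<lambda>n. coeff2 (H n)) (coeff2 hs)"
    using torus_lim_coeffs[OF H(2-4)] by auto
  have "torus_lim (\<lambda>n. density_deriv q p (H n) (U n)) (density_deriv q p hs u)"
    unfolding density_deriv_def H(2) power2_eq_square
    by (intro torus_lim_add torus_lim_mult comp q p r m two coeffs)
  then have ul: "uniform_limit {0..1} (\<lambda>n. density_deriv q p (H n) (U n)) (density_deriv q p hs u) sequentially"
    unfolding torus_lim_def using uniform_limit_on_subset by blast
  have cont: "continuous_on {0..1} (density_deriv q p (H n) (U n))" for n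
    by (intro smooth_torus_continuous smooth_torus_density_deriv[OF q p U(1) H(1)])
  obtain J K where J: "\<And>n. (density_deriv q p (H n) (U n) has_integral J n) {0..1}"
    and K: "(density_deriv q p hs u has_integral K) {0..1}" and lim: "J \<longlonglongrightarrow> K"
    by (rule uniform_limit_integral[OF ul cont sequentially_bot]) (rule that)
  show ?thesis
    using lim unfolding torus_integralI[OF J] torus_integralI[OF K] .
qed

section \<open>The barotropic system\<close>

lemma smooth_functional_barotropic_energy:
  assumes p: "smooth_on {0<..} p"
  shows "smooth_functional c1 c2 (barotropic_energy \<beta> p)"
proof -
  define q :: "real \<Rightarrow> real" where "q = (\<lambda>s. 1 / (2 * s))"
  have q: "smooth_on {0<..} q"
    unfolding q_def by (intro smooth_on_divide smooth_on_cmult smooth_on_ident smooth_on_const) auto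
  let ?D = "\<lambda>hs u. \<beta> * torus_integral (density_deriv q p hs u)"
  have "?D [] u = barotropic_energy \<beta> p u" for u
    by (simp add: density_deriv_def barotropic_energy_def q_def)
  moreover have "((\<lambda>s. ?D hs (shift u h s)) has_real_derivative ?D (h # hs) u) (at 0)"
    if "u \<in> state_space c1 c2" "h \<in> tangent_space" "set hs \<subseteq> tangent_space" for u h hs
    by (intro DERIV_cmult integral_density_deriv_step[OF q p that])
  moreover have "(\<lambda>n. ?D (H n) (U n)) \<longlonglongrightarrow> ?D hs u"
    if "(\<forall>n. U n \<in> state_space c1 c2) \<and> u \<in> state_space c1 c2 \<and>
           (\<forall>n. set (H n) \<subseteq> tangent_space \<and> length (H n) = length hs) \<and>
           set hs \<subseteq> tangent_space \<and>
           state_conv U u \<and> (\<forall>i < length hs. state_conv (\<lambda>n. H n ! i) (hs ! i))" for U u H hs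
    using that by (intro tendsto_mult_left integral_density_deriv_tendsto[OF q p]) auto
  ultimately show ?thesis
    unfolding smooth_functional_def by (intro exI[of _ ?D] conjI ballI allI impI) auto
qed

lemma smooth_on_pressure_potential:
  assumes P: "smooth_on {0<..} P"
    and Phat: "\<And>s. s > 0 \<Longrightarrow> Phat differentiable (at s)"
      "\<And>s. s > 0 \<Longrightarrow> (deriv Phat has_real_derivative deriv P s / s) (at s)"
  shows "smooth_on {0<..} Phat"
proof -
  have "smooth_on {0<..} (\<lambda>s. deriv P s / s)"
    by (intro smooth_on_divide smooth_on_deriv P smooth_on_ident) auto
  then have "smooth_on {0<..} (deriv Phat)"
    by (rule smooth_on_antiderivative[OF open_greaterThan]) (simp add: Phat(2))
  then show ?thesis
    by (rule smooth_on_antiderivative[OF open_greaterThan])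
      (simp add: Phat(1) DERIV_deriv_iff_real_differentiable)
qed

definition barotropic_var_density :: "real \<Rightarrow> (real \<Rightarrow> real) \<Rightarrow> state \<Rightarrow> torus_fun" where
  "barotropic_var_density \<beta> p u = (\<lambda>x. \<beta> * (deriv p (fst u x) - (snd u x)\<^sup>2 / (2 * (fst u x)\<^sup>2)))"

definition barotropic_var_momentum :: "real \<Rightarrow> state \<Rightarrow> torus_fun" where
  "barotropic_var_momentum \<beta> u = (\<lambda>x. \<beta> * (snd u x / fst u x))"

lemma first_variations_barotropic_energy:
  assumes p: "smooth_on {0<..} p"
  shows "first_variations c1 c2 (barotropic_energy \<beta> p)
    (barotropic_var_density \<beta> p) (barotropic_var_momentum \<beta>)"
  unfolding first_variations_def
proof (intro ballI conjI)
  fix u assume u: "u \<in> state_space c1 c2"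
  have nz: "fst u x \<noteq> 0" for x
    using state_spaceD(3)[OF u, of x] by simp
  have comp: "(\<lambda>x. deriv p (fst u x)) \<in> smooth_torus"
    using smooth_torus_compose[OF smooth_on_deriv[OF p]] state_spaceD(1,3)[OF u] by simp
  show "barotropic_var_density \<beta> p u \<in> smooth_torus"
    unfolding barotropic_var_density_def
    by (intro smooth_torus_cmult smooth_torus_diff smooth_torus_divide smooth_torus_power comp
        state_spaceD(1,2)[OF u]) (simp add: nz)
  show "barotropic_var_momentum \<beta> u \<in> smooth_torus"
    unfolding barotropic_var_momentum_def
    by (intro smooth_torus_cmult smooth_torus_divide state_spaceD(1,2)[OF u]) (simp add: nz)
  fix h assume h: "h \<in> tangent_space"
  define q :: "real \<Rightarrow> real" where "q = (\<lambda>s. 1 / (2 * s))"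
  have q: "smooth_on {0<..} q"
    unfolding q_def by (intro smooth_on_divide smooth_on_cmult smooth_on_ident smooth_on_const) auto
  have deriv_q: "deriv q s = - 1 / (2 * s\<^sup>2)" if "s \<noteq> 0" for s
    unfolding q_def
    by (rule DERIV_imp_deriv) (use that in \<open>auto intro!: derivative_eq_intros simp: power2_eq_square\<close>)
  have E: "barotropic_energy \<beta> p v = \<beta> * torus_integral (density_deriv q p [] v)" for v
    by (simp add: barotropic_energy_def fun_eq_iff density_deriv_def q_def)
  have "\<beta> * density_deriv q p [h] u x =
      barotropic_var_density \<beta> p u x * fst h x + barotropic_var_momentum \<beta> u x * snd h x" for x
    using nz[of x]
    by (simp add: density_deriv_def deriv_q fun_cong[OF q_def] barotropic_var_density_def
        barotropic_var_momentum_def field_simps power2_eq_square)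
  then have "\<beta> * torus_integral (density_deriv q p [h] u) =
      torus_integral (\<lambda>x. barotropic_var_density \<beta> p u x * fst h x + barotropic_var_momentum \<beta> u x * snd h x)"
    by (simp flip: torus_integral_cmult)
  then show "((\<lambda>s. barotropic_energy \<beta> p (shift u h s)) has_real_derivative
      torus_integral (\<lambda>x. barotropic_var_density \<beta> p u x * fst h x + barotropic_var_momentum \<beta> u x * snd h x))
      (at 0)"
    unfolding E using DERIV_cmult[OF integral_density_deriv_step[OF q p u h, of "[]"], of \<beta>] by simp
qed

lemma admissible_barotropic_flux:
  assumes P: "smooth_on {0<..} P" and p: "smooth_on {0<..} p"
    and p2: "\<And>s. s > 0 \<Longrightarrow> (deriv p has_real_derivative deriv P s / s) (at s)"
    and fv: "first_variations c1 c2 (barotropic_energy \<beta> p) dr dm"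
  shows "admissible_flux c1 c2 dr dm barotropic_flux1 (barotropic_flux2 P)"
  unfolding admissible_flux_def
proof (intro ballI conjI)
  fix u assume u: "u \<in> state_space c1 c2"
  define r m where "r = fst u" and "m = snd u"
  have rm: "r \<in> smooth_torus" "m \<in> smooth_torus" and pos: "r x > 0" for x
    using state_spaceD[OF u] by (auto simp: r_def m_def)
  have nz: "r x \<noteq> 0" for x
    using pos[of x] by simp
  have comp: "(\<lambda>x. P (r x)) \<in> smooth_torus"
    by (rule smooth_torus_compose[OF P rm(1)]) (simp add: pos)
  show "barotropic_flux1 u \<in> smooth_torus"
    using rm by (simp add: barotropic_flux1_def m_def)
  show "barotropic_flux2 P u \<in> smooth_torus"
    unfolding barotropic_flux2_def r_def[symmetric] m_def[symmetric]
    by (intro smooth_torus_add smooth_torus_divide smooth_torus_power comp rm nz)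
  note r' = smooth_torus_has_deriv[OF rm(1)] and m' = smooth_torus_has_deriv[OF rm(2)]
  note fv0 = first_variations_barotropic_energy[OF p, of c1 c2 \<beta>]
  have P': "((\<lambda>x. P (r x)) has_real_derivative deriv P (r x) * deriv r x) (at x)" for x
    using pos by (intro DERIV_chain2[OF smooth_on_has_deriv[OF P] r']) simp
  have p': "((\<lambda>x. deriv p (r x)) has_real_derivative deriv P (r x) / r x * deriv r x) (at x)" for x
    by (rule DERIV_chain2[OF p2[OF pos] r'])
  have sq: "((\<lambda>x. (m x)\<^sup>2 / (2 * (r x)\<^sup>2)) has_real_derivative
      m x * deriv m x / (r x)\<^sup>2 - (m x)\<^sup>2 * deriv r x / r x ^ 3) (at x)" for x
    by (rule derivative_eq_intros r' m' refl)+
      (use nz in \<open>simp_all add: field_simps power2_eq_square power3_eq_cube\<close>)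
  have dr: "deriv (dr u) x =
      \<beta> * (deriv P (r x) / r x * deriv r x - (m x * deriv m x / (r x)\<^sup>2 - (m x)\<^sup>2 * deriv r x / r x ^ 3))" for x
    unfolding first_variations_deriv_unique(1)[OF fv fv0 u] barotropic_var_density_def
      r_def[symmetric] m_def[symmetric]
    by (intro DERIV_imp_deriv DERIV_cmult DERIV_diff p' sq)
  have quot: "((\<lambda>x. m x / r x) has_real_derivative deriv m x / r x - m x * deriv r x / (r x)\<^sup>2) (at x)" for x
    by (rule derivative_eq_intros r' m' refl)+ (use nz in \<open>simp_all add: field_simps power2_eq_square\<close>)
  have dm: "deriv (dm u) x = \<beta> * (deriv m x / r x - m x * deriv r x / (r x)\<^sup>2)" for x
    unfolding first_variations_deriv_unique(2)[OF fv fv0 u] barotropic_var_momentum_def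
      r_def[symmetric] m_def[symmetric]
    by (intro DERIV_imp_deriv DERIV_cmult quot)
  have work: "deriv (\<lambda>x. P (r x) * (m x / r x)) x =
      deriv P (r x) * deriv r x * (m x / r x) + (deriv m x / r x - m x * deriv r x / (r x)\<^sup>2) * P (r x)" for x
    by (intro DERIV_imp_deriv DERIV_mult P' quot)
  have "barotropic_flux1 u x * deriv (dr u) x + barotropic_flux2 P u x * deriv (dm u) x =
      \<beta> * deriv (\<lambda>x. P (r x) * (m x / r x)) x" for x
    unfolding dr dm work barotropic_flux1_def barotropic_flux2_def r_def[symmetric] m_def[symmetric]
    using nz[of x] by (simp add: field_simps power2_eq_square power3_eq_cube)
  moreover have "torus_integral (deriv (\<lambda>x. P (r x) * (m x / r x))) = 0"
    by (intro torus_integral_deriv smooth_torus_mult smooth_torus_divide comp rm nz)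
  ultimately show "torus_integral (\<lambda>x. barotropic_flux1 u x * deriv (dr u) x +
      barotropic_flux2 P u x * deriv (dm u) x) = 0"
    by (simp add: torus_integral_cmult)
qed

lemma dissipative_system_iff_barotropic_navier_stokes:
  assumes smooth: "smooth_on {0<..} \<mu>" and pos: "\<And>s. s > 0 \<Longrightarrow> \<mu> s > 0"
    and P: "smooth_on {0<..} P" and p: "smooth_on {0<..} p"
    and fv: "first_variations c1 c2 (barotropic_energy \<beta> p) dr dm"
    and state: "\<And>t. t \<in> I \<Longrightarrow> (r t, m t) \<in> state_space c1 c2"
  shows "dissipative_system \<mu> dm barotropic_flux1 (barotropic_flux2 P) I r m \<longleftrightarrow>
    barotropic_navier_stokes \<beta> \<mu> P I r m"
proof -
  have "deriv (barotropic_flux2 P (r t, m t)) x =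
      deriv (\<lambda>y. (m t y)\<^sup>2 / r t y) x + deriv (\<lambda>y. P (r t y)) x \<and>
    deriv (\<lambda>y. \<mu> (r t y) * deriv (dm (r t, m t)) y) x =
      \<beta> * deriv (\<lambda>y. \<mu> (r t y) * deriv (\<lambda>z. m t z / r t z) y) x" if t: "t \<in> I" for t x
  proof
    note u = state[OF t]
    have rm: "r t \<in> smooth_torus" "m t \<in> smooth_torus" and rpos: "r t y > 0" for y
      using state_spaceD(1-3)[OF u] by auto
    have nz: "r t y \<noteq> 0" for y
      using rpos[of y] by simp
    have "(\<lambda>y. P (r t y)) \<in> smooth_torus"
      by (rule smooth_torus_compose[OF P rm(1)]) (simp add: rpos)
    moreover have "(\<lambda>y. (m t y)\<^sup>2 / r t y) \<in> smooth_torus"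
      by (intro smooth_torus_divide smooth_torus_power rm nz)
    ultimately show "deriv (barotropic_flux2 P (r t, m t)) x =
        deriv (\<lambda>y. (m t y)\<^sup>2 / r t y) x + deriv (\<lambda>y. P (r t y)) x"
      unfolding barotropic_flux2_def fst_conv snd_conv
      by (intro DERIV_imp_deriv DERIV_add smooth_torus_has_deriv)
    have v: "(\<lambda>z. m t z / r t z) \<in> smooth_torus"
      by (intro smooth_torus_divide rm nz)
    have J: "(\<lambda>y. \<mu> (r t y) * deriv (\<lambda>z. m t z / r t z) y) \<in> smooth_torus"
      using smooth_torus_weighted_deriv[OF smooth pos u v] by simp
    have "deriv (dm (r t, m t)) y = \<beta> * deriv (\<lambda>z. m t z / r t z) y" for y
      unfolding first_variations_deriv_unique(2)[OF fv first_variations_barotropic_energy[OF p] u]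
        barotropic_var_momentum_def fst_conv snd_conv
      by (intro DERIV_imp_deriv DERIV_cmult smooth_torus_has_deriv v)
    then have "(\<lambda>y. \<mu> (r t y) * deriv (dm (r t, m t)) y) =
        (\<lambda>y. \<beta> * (\<mu> (r t y) * deriv (\<lambda>z. m t z / r t z) y))"
      by (simp add: mult_ac)
    then show "deriv (\<lambda>y. \<mu> (r t y) * deriv (dm (r t, m t)) y) x =
        \<beta> * deriv (\<lambda>y. \<mu> (r t y) * deriv (\<lambda>z. m t z / r t z) y) x"
      by (simp only:) (intro DERIV_imp_deriv DERIV_cmult smooth_torus_has_deriv J)
  qed
  then show ?thesis
    by (auto simp: dissipative_system_def barotropic_navier_stokes_def barotropic_flux1_def add.assoc)
qed

theorem mainTheorem3:
  fixes c1 c2 :: real and \<mu> :: "real \<Rightarrow> real"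
  assumes "c1 > 0"
    and "smooth_on {0<..} \<mu>"
    and "\<And>s. s > 0 \<Longrightarrow> \<mu> s > 0"
  shows
    "(\<forall>(E :: state \<Rightarrow> real) dr dm f1 f2.
       smooth_functional c1 c2 E \<longrightarrow>
       first_variations c1 c2 E dr dm \<longrightarrow>
       admissible_flux c1 c2 dr dm f1 f2 \<longrightarrow>
         (\<forall>u \<in> state_space c1 c2. \<forall>w.
            is_metric_gradient \<mu> E u w \<longleftrightarrow> w = onsager \<mu> u (dr u, dm u)) \<and>
         (\<forall>I r m. smooth_evolution c1 c2 I r m \<longrightarrow>
            (flux_gradient_flow c1 c2 \<mu> E dr dm f1 f2 I r m \<longleftrightarrow>
               dissipative_system \<mu> dm f1 f2 I r m) \<and>
            (dissipative_system \<mu> dm f1 f2 I r m \<longrightarrow>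
               (\<forall>t\<in>I. ((\<lambda>s. E (r s, m s)) has_real_derivative
                  - torus_integral (\<lambda>x. \<bar>deriv (dm (r t, m t)) x\<bar>\<^sup>2 * \<mu> (r t x))) (at t within I)))))
     \<and>
     (\<forall>(\<beta> :: real) (P :: real \<Rightarrow> real) (Phat :: real \<Rightarrow> real).
       \<beta> > 0 \<longrightarrow>
       smooth_on {0<..} P \<longrightarrow>
       (\<forall>s>0. Phat differentiable (at s) \<and>
          (deriv Phat has_real_derivative deriv P s / s) (at s)) \<longrightarrow>
         smooth_functional c1 c2 (barotropic_energy \<beta> Phat) \<and>
         (\<exists>dr dm. first_variations c1 c2 (barotropic_energy \<beta> Phat) dr dm) \<and>
         (\<forall>dr dm. first_variations c1 c2 (barotropic_energy \<beta> Phat) dr dm \<longrightarrow>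
            admissible_flux c1 c2 dr dm barotropic_flux1 (barotropic_flux2 P) \<and>
            (\<forall>I r m. smooth_evolution c1 c2 I r m \<longrightarrow>
               (flux_gradient_flow c1 c2 \<mu> (barotropic_energy \<beta> Phat) dr dm
                  barotropic_flux1 (barotropic_flux2 P) I r m \<longleftrightarrow>
                  barotropic_navier_stokes \<beta> \<mu> P I r m))))"
proof (intro conjI allI impI)
  note mobility = assms(2,3)
  fix E :: "state \<Rightarrow> real" and dr dm f1 f2
  assume E: "smooth_functional c1 c2 E" and fv: "first_variations c1 c2 E dr dm"
    and flux: "admissible_flux c1 c2 dr dm f1 f2"
  show "\<forall>u \<in> state_space c1 c2. \<forall>w. is_metric_gradient \<mu> E u w \<longleftrightarrow> w = onsager \<mu> u (dr u, dm u)"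
    using is_metric_gradient_iff_onsager[OF mobility fv] by blast
  fix I r m assume ev: "smooth_evolution c1 c2 I r m"
  show "flux_gradient_flow c1 c2 \<mu> E dr dm f1 f2 I r m \<longleftrightarrow> dissipative_system \<mu> dm f1 f2 I r m"
    by (rule flux_gradient_flow_iff_dissipative_system[OF fv flux])
  assume "dissipative_system \<mu> dm f1 f2 I r m"
  then show "\<forall>t\<in>I. ((\<lambda>s. E (r s, m s)) has_real_derivative
      - torus_integral (\<lambda>x. \<bar>deriv (dm (r t, m t)) x\<bar>\<^sup>2 * \<mu> (r t x))) (at t within I)"
    using dissipation_identity[OF mobility E fv flux ev] by blast
next
  note mobility = assms(2,3)
  fix \<beta> :: real and P Phat :: "real \<Rightarrow> real"
  assume P: "smooth_on {0<..} P" and Phat: "\<forall>s>0. Phat differentiable (at s) \<and>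
    (deriv Phat has_real_derivative deriv P s / s) (at s)"
  have smooth: "smooth_on {0<..} Phat"
    using Phat by (intro smooth_on_pressure_potential[OF P]) auto
  show "smooth_functional c1 c2 (barotropic_energy \<beta> Phat)"
    by (rule smooth_functional_barotropic_energy[OF smooth])
  show "\<exists>dr dm. first_variations c1 c2 (barotropic_energy \<beta> Phat) dr dm"
    using first_variations_barotropic_energy[OF smooth] by blast
  fix dr dm assume fv: "first_variations c1 c2 (barotropic_energy \<beta> Phat) dr dm"
  show flux: "admissible_flux c1 c2 dr dm barotropic_flux1 (barotropic_flux2 P)"
    using Phat by (intro admissible_barotropic_flux[OF P smooth _ fv]) auto
  fix I r m assume "smooth_evolution c1 c2 I r m"
  then have "\<And>t. t \<in> I \<Longrightarrow> (r t, m t) \<in> state_space c1 c2"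
    by (simp add: smooth_evolution_def)
  then show "flux_gradient_flow c1 c2 \<mu> (barotropic_energy \<beta> Phat) dr dm
      barotropic_flux1 (barotropic_flux2 P) I r m \<longleftrightarrow> barotropic_navier_stokes \<beta> \<mu> P I r m"
    using flux_gradient_flow_iff_dissipative_system[OF fv flux]
      dissipative_system_iff_barotropic_navier_stokes[OF mobility P smooth fv] by blast
qed

end
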